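(* Let $V$ be a superspace of dimension $n|m$ and $1\le k\le n$. An even multivector $T=T^{a_1\dots a_k}e_{a_1}\wedge\dots\wedge e_{a_k}\in\Lambda^k(V)$ is simple (i.e. $T=\mathbf u_1\wedge\dots\wedge\mathbf u_k$ for some independent even vectors $\mathbf u_i$, and thus defines a $k$-plane $L=\mathrm{span}(\mathbf u_1,\dots,\mathbf u_k)\subset V$) if and only if it is non-degenerate and its components satisfy $$T^{a_1\ldots a_{k-1}b}\,T^{c_1\ldots c_k}(-1)^{\tilde b(\tilde a_1+\ldots+\tilde a_{k-1}+\tilde c_1+\ldots+\tilde c_k)} =\sum_{j=1}^{k}T^{a_1\ldots a_{k-1}c_j}\,T^{c_1\ldots c_{j-1}bc_{j+1}\ldots c_k}(-1)^{\tilde b(\tilde c_1+\ldots+\tilde c_{j-1})+\tilde c_j(\tilde a_1+\ldots+\tilde a_{k-1}+\tilde c_{j+1}+\ldots+\tilde c_k)}$$ for all combinations of indices $a_1,\dots,a_{k-1},b,c_1,\dots,c_k\in\{1,\dots,n\}\cup\{\hat1,\dots,\hat m\}$.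
   Context: Conventions. $A$ is a fixed nonzero commutative superalgebra over $\mathbb R$ (coefficients may be odd), and $V$ is a free left $A$-module of rank $n|m$ with homogeneous basis $e_a$, $a\in\{1,\dots,n\}\cup\{\hat1,\dots,\hat m\}$; the parity $\tilde a$ is $0$ for $a\in\{1,\dots,n\}$ ("even indices") and $1$ for $a\in\{\hat 1,\dots,\hat m\}$ ("odd indices"). The exterior algebra is $\Lambda(V)=T(V)/\langle v\otimes w+(-1)^{\tilde v\tilde w}w\otimes v\rangle$. Every even $T\in\Lambda^k(V)$ is written $T=T^{a_1\dots a_k}e_{a_1}\wedge\dots\wedge e_{a_k}$ (summation over all index values), where $T^{a_1\dots a_k}\in A$ has parity $\tilde a_1+\dots+\tilde a_k$ and $T^{a_1\dots a_ia_{i+1}\dots a_k}=-(-1)^{\tilde a_i\tilde a_{i+1}}T^{a_1\dots a_{i+1}a_i\dots a_k}$. $T$ is non-degenerate if at least one component $T^{a_1\dots a_k}$ with all indices even is invertible. Even vectors $\mathbf u_1,\dots,\mathbf u_k$ are independent if the $k\times(n|m)$ matrix of their coordinates contains an invertible $k\times k$ submatrix formed by $k$ of the $n$ even columns. *)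

theory Defs
  imports "HOL-Analysis.Analysis" "HOL-Algebra.QuotRing" "Jordan_Normal_Form.Matrix"
begin

text \<open>
  A commutative superalgebra over the reals. The type \<open>'a\<close> is the whole algebra (it is
  unital, associative and nonzero by its type class), and \<open>A p\<close> is its homogeneous part of
  parity \<open>p\<close> modulo 2; indexing by natural numbers makes \<open>A (p + q)\<close> and \<open>(-1) ^ (p * q)\<close>
  meaningful as they stand.
\<close>

definition comm_superalgebra :: "(nat \<Rightarrow> 'a::real_algebra_1 set) \<Rightarrow> bool" where
  "comm_superalgebra A \<longleftrightarrow>
     (\<forall>p. subspace (A p)) \<and>
     (\<forall>p. A (p + 2) = A p) \<and>
     A 0 \<inter> A 1 = {0} \<and>
     (\<forall>x. \<exists>y\<in>A 0. \<exists>z\<in>A 1. x = y + z) \<and>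
     1 \<in> A 0 \<and>
     (\<forall>p q. \<forall>x\<in>A p. \<forall>y\<in>A q. x * y \<in> A (p + q) \<and> x * y = (-1) ^ (p * q) * (y * x))"

definition invertible_elem :: "'a::ring_1 \<Rightarrow> bool" where
  "invertible_elem x \<longleftrightarrow> (\<exists>y. x * y = 1 \<and> y * x = 1)"

text \<open>
  The map \<open>y + z \<mapsto> y + (-1)^p z\<close> (\<open>y\<close> even, \<open>z\<close> odd): the effect on a
  coefficient of moving it past an object of parity \<open>p\<close>.
\<close>

definition koszul :: "(nat \<Rightarrow> 'a::real_algebra_1 set) \<Rightarrow> nat \<Rightarrow> 'a \<Rightarrow> 'a" where
  "koszul A p x = (THE x'. \<exists>y\<in>A 0. \<exists>z\<in>A 1. x = y + z \<and> x' = y + (-1) ^ p * z)"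

text \<open>The indices: \<open>Inl a\<close> stands for \<open>a\<close> and \<open>Inr a\<close> for \<open>a\<close> with a hat.\<close>

type_synonym sindex = "nat + nat"

definition indices :: "nat \<Rightarrow> nat \<Rightarrow> sindex set" where
  "indices n m = Inl ` {1..n} \<union> Inr ` {1..m}"

definition par :: "sindex \<Rightarrow> nat" where
  "par a = (case a of Inl _ \<Rightarrow> 0 | Inr _ \<Rightarrow> 1)"

definition wpar :: "sindex list \<Rightarrow> nat" where
  "wpar w = sum_list (map par w)"

definition words :: "nat \<Rightarrow> nat \<Rightarrow> nat \<Rightarrow> sindex list set" where
  "words n m k = {w. length w = k \<and> set w \<subseteq> indices n m}"

text \<open>
  The free left module of rank \<open>n|m\<close>: a vector is given by its left coordinates, and
  \<open>homogeneous_vectors A n m p\<close> are the vectors of parity \<open>p\<close>.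
\<close>

definition homogeneous_vectors ::
  "(nat \<Rightarrow> 'a::real_algebra_1 set) \<Rightarrow> nat \<Rightarrow> nat \<Rightarrow> nat \<Rightarrow> (sindex \<Rightarrow> 'a) set" where
  "homogeneous_vectors A n m p =
     {v. (\<forall>a\<in>indices n m. v a \<in> A (p + par a)) \<and> (\<forall>a. a \<notin> indices n m \<longrightarrow> v a = 0)}"

text \<open>
  The tensor algebra of that module over the superalgebra. It is the free left module on the
  words \<open>e\<^sub>w\<close> in the basis (the empty word spans the scalars), an element being the
  family of its left coefficients. The product is concatenation of words, with
  \<open>(x e\<^sub>u)(y e\<^sub>v) = (-1)^(par u * par y) x y e\<^sub>u\<^sub>v\<close> for homogeneous \<open>y\<close>.
\<close>

definition tensor_algebra ::
  "(nat \<Rightarrow> 'a::real_algebra_1 set) \<Rightarrow> nat \<Rightarrow> nat \<Rightarrow> (sindex list \<Rightarrow> 'a) ring" where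
  "tensor_algebra A n m =
     \<lparr> carrier = {p. finite {w. p w \<noteq> 0} \<and> (\<forall>w. p w \<noteq> 0 \<longrightarrow> set w \<subseteq> indices n m)},
       mult = (\<lambda>p q w. \<Sum>i\<le>length w. p (take i w) * koszul A (wpar (take i w)) (q (drop i w))),
       one = (\<lambda>w. if w = [] then 1 else 0),
       zero = (\<lambda>w. 0),
       add = (\<lambda>p q w. p w + q w) \<rparr>"

definition scalar_tensor :: "'a::zero \<Rightarrow> sindex list \<Rightarrow> 'a" where
  "scalar_tensor x = (\<lambda>w. if w = [] then x else 0)"

definition vector_tensor :: "(sindex \<Rightarrow> 'a::zero) \<Rightarrow> sindex list \<Rightarrow> 'a" where
  "vector_tensor v = (\<lambda>w. case w of [a] \<Rightarrow> v a | _ \<Rightarrow> 0)"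

definition basis_vector :: "sindex \<Rightarrow> sindex \<Rightarrow> 'a::zero_neq_one" where
  "basis_vector a = (\<lambda>b. if b = a then 1 else 0)"

definition exterior_relators ::
  "(nat \<Rightarrow> 'a::real_algebra_1 set) \<Rightarrow> nat \<Rightarrow> nat \<Rightarrow> (sindex list \<Rightarrow> 'a) set" where
  "exterior_relators A n m =
     {(vector_tensor v \<otimes>\<^bsub>tensor_algebra A n m\<^esub> vector_tensor w)
        \<oplus>\<^bsub>tensor_algebra A n m\<^esub>
      (scalar_tensor ((-1) ^ (p * q)) \<otimes>\<^bsub>tensor_algebra A n m\<^esub>
        (vector_tensor w \<otimes>\<^bsub>tensor_algebra A n m\<^esub> vector_tensor v)) | p q v w.
      v \<in> homogeneous_vectors A n m p \<and> w \<in> homogeneous_vectors A n m q}"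

definition exterior_ideal ::
  "(nat \<Rightarrow> 'a::real_algebra_1 set) \<Rightarrow> nat \<Rightarrow> nat \<Rightarrow> (sindex list \<Rightarrow> 'a) set" where
  "exterior_ideal A n m = genideal (tensor_algebra A n m) (exterior_relators A n m)"

definition exterior_algebra ::
  "(nat \<Rightarrow> 'a::real_algebra_1 set) \<Rightarrow> nat \<Rightarrow> nat \<Rightarrow> (sindex list \<Rightarrow> 'a) set ring" where
  "exterior_algebra A n m = tensor_algebra A n m Quot exterior_ideal A n m"

definition ext_class ::
  "(nat \<Rightarrow> 'a::real_algebra_1 set) \<Rightarrow> nat \<Rightarrow> nat \<Rightarrow> (sindex list \<Rightarrow> 'a) \<Rightarrow> (sindex list \<Rightarrow> 'a) set" where
  "ext_class A n m p = exterior_ideal A n m +>\<^bsub>tensor_algebra A n m\<^esub> p"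

definition wedge ::
  "(nat \<Rightarrow> 'a::real_algebra_1 set) \<Rightarrow> nat \<Rightarrow> nat \<Rightarrow> (sindex \<Rightarrow> 'a) list \<Rightarrow> (sindex list \<Rightarrow> 'a) set" where
  "wedge A n m vs =
     foldr (mult (exterior_algebra A n m)) (map (\<lambda>v. ext_class A n m (vector_tensor v)) vs)
       (one (exterior_algebra A n m))"

text \<open>
  The even elements of the \<open>k\<close>-th exterior power. Parity is the total one, in which a
  coefficient and the basis word it multiplies both count.
\<close>

definition even_multivectors ::
  "(nat \<Rightarrow> 'a::real_algebra_1 set) \<Rightarrow> nat \<Rightarrow> nat \<Rightarrow> nat \<Rightarrow> (sindex list \<Rightarrow> 'a) set set" where
  "even_multivectors A n m k =
     ext_class A n m ` {p \<in> carrier (tensor_algebra A n m).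
        (\<forall>w. p w \<noteq> 0 \<longrightarrow> length w = k) \<and> (\<forall>w. p w \<in> A (wpar w))}"

text \<open>
  \<open>is_components A n m k T t\<close>: the family \<open>t\<close> is the one occurring in the
  expansion of \<open>T\<close> over all words, with its parity and symmetry. Every even multivector has
  exactly one such family (\<open>k!\<close> is invertible), once \<open>t\<close> is set to 0 outside the words
  of length \<open>k\<close>.
\<close>

definition is_components ::
  "(nat \<Rightarrow> 'a::real_algebra_1 set) \<Rightarrow> nat \<Rightarrow> nat \<Rightarrow> nat \<Rightarrow> (sindex list \<Rightarrow> 'a) set
     \<Rightarrow> (sindex list \<Rightarrow> 'a) \<Rightarrow> bool" where
  "is_components A n m k T t \<longleftrightarrow>
     T = finsum (exterior_algebra A n m)
           (\<lambda>w. ext_class A n m (scalar_tensor (t w)) \<otimes>\<^bsub>exterior_algebra A n m\<^esub>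
                  wedge A n m (map basis_vector w))
           (words n m k) \<and>
     (\<forall>w\<in>words n m k. t w \<in> A (wpar w)) \<and>
     (\<forall>xs a b ys. xs @ [a, b] @ ys \<in> words n m k \<longrightarrow>
        t (xs @ [a, b] @ ys) = - ((-1) ^ (par a * par b) * t (xs @ [b, a] @ ys))) \<and>
     (\<forall>w. w \<notin> words n m k \<longrightarrow> t w = 0)"

definition mv_components ::
  "(nat \<Rightarrow> 'a::real_algebra_1 set) \<Rightarrow> nat \<Rightarrow> nat \<Rightarrow> nat \<Rightarrow> (sindex list \<Rightarrow> 'a) set
     \<Rightarrow> sindex list \<Rightarrow> 'a" where
  "mv_components A n m k T = (THE t. is_components A n m k T t)"

definition nondegenerate ::
  "(nat \<Rightarrow> 'a::real_algebra_1 set) \<Rightarrow> nat \<Rightarrow> nat \<Rightarrow> nat \<Rightarrow> (sindex list \<Rightarrow> 'a) set \<Rightarrow> bool" where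
  "nondegenerate A n m k T \<longleftrightarrow>
     (\<exists>w\<in>words n m k. (\<forall>a\<in>set w. par a = 0) \<and> invertible_elem (mv_components A n m k T w))"

text \<open>Here \<open>c\<close> chooses \<open>k\<close> of the \<open>n\<close> even columns.\<close>

definition independent_vectors :: "nat \<Rightarrow> nat \<Rightarrow> (nat \<Rightarrow> sindex \<Rightarrow> 'a::ring_1) \<Rightarrow> bool" where
  "independent_vectors n k u \<longleftrightarrow>
     (\<exists>c. c ` {..<k} \<subseteq> {1..n} \<and> inj_on c {..<k} \<and>
          invertible_mat (mat k k (\<lambda>(i, j). u i (Inl (c j)))))"

definition simple_multivector ::
  "(nat \<Rightarrow> 'a::real_algebra_1 set) \<Rightarrow> nat \<Rightarrow> nat \<Rightarrow> nat \<Rightarrow> (sindex list \<Rightarrow> 'a) set \<Rightarrow> bool" where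
  "simple_multivector A n m k T \<longleftrightarrow>
     (\<exists>u. (\<forall>i<k. u i \<in> homogeneous_vectors A n m 0) \<and> independent_vectors n k u \<and>
          T = wedge A n m (map u [0..<k]))"

end

theory Submission
  imports Defs "HOL-Combinatorics.Multiset_Permutations"
begin

text \<open>
  The relators of the exterior algebra are exactly the tensors that are supersymmetric in two
  adjacent indices, so the exterior ideal consists of sums of tensors supersymmetric at some pair of
  adjacent positions; super-antisymmetrization kills all of them and is \<open>k!\<close> times the
  identity on super-antisymmetric families, whence existence and uniqueness of components.

  The components of \<open>u\<^sub>1 \<and> \<dots> \<and> u\<^sub>k\<close> are, up to a sign and \<open>k!\<close>, determinants with
  ordered columns. Expanding a determinant with a repeated row gives Cramer's rule, and multiplying it
  by the cofactors of a last column \<open>b\<close> gives the Pluecker relations. Non-degeneracy holds because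
  the unit columns are combinations of the columns of an invertible matrix, so that the determinant of
  the latter divides \<open>1\<close>. Conversely, if \<open>t cs\<close> is an invertible component with even indices,
  the vectors with coordinates \<open>t (cs[i := b]) / t cs\<close> (one of them rescaled) have a wedge product
  whose components agree with \<open>t\<close> on \<open>cs\<close> and on all \<open>cs[i := b]\<close>; the relations
  determine all other components from these.
\<close>

text \<open>All signs are organised around one fact: the rows are even vectors, so the entry
  \<open>u i a\<close> has the parity of its column \<open>a\<close>, whatever the row. Exchanging
  columns costs Koszul signs, exchanging rows does not. Odd columns are the obstacle: their entries
  anticommute, are never invertible, and a word with a repeated odd letter can have a nonzero
  component. The arguments are therefore linear in one column at a time. The cofactors of the last
  column stand to the left of its entries, so Cramer's rule for these entries can be multiplied by
  the cofactors without moving a factor. In the converse the reference word consists of even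
  letters, since for them a repetition forces the component to vanish; this makes the constructed
  matrix diagonal on the columns \<open>cs\<close>. The relation with last index \<open>b\<close>
  trades a letter \<open>b\<close> outside the reference word, even or odd, for letters of that
  word. The factor \<open>1 / fact k\<close> between determinants and components comes from summing
  over all words instead of increasing ones, and explains the \<open>fact k\<close> in the rescaled
  vector.\<close>

definition ksign :: "nat \<Rightarrow> real" where
  "ksign n = (-1) ^ n"

lemma ksign_0 [simp]: "ksign 0 = 1"
  and ksign_add: "ksign (m + n) = ksign m * ksign n"
  and ksign_square [simp]: "ksign n * ksign n = 1"
  and ksign_square_left [simp]: "ksign n * (ksign n * x) = x"
  and ksign_nonzero [simp]: "ksign n \<noteq> 0"
proof -
  show sq: "ksign n * ksign n = 1" by (cases "even n") (auto simp: ksign_def)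
  then show "ksign n * (ksign n * x) = x" by (simp flip: mult.assoc)
qed (auto simp: ksign_def power_add)

lemma ksign_if: "ksign n = (if even n then 1 else -1)"
  by (simp add: ksign_def)

lemma ksign_Suc: "ksign (Suc n) = - ksign n"
  by (simp add: ksign_def)

lemma ksign_eq: "even m = even n \<Longrightarrow> ksign m = ksign n"
  by (simp add: ksign_if)

text \<open>Signs written in the algebra become real scalars, which pass through every product
  without commutation rules.\<close>

lemma ksign_scaleR: "(-1) ^ n * (x :: 'a :: real_algebra_1) = ksign n *\<^sub>R x"
  by (cases "even n") (auto simp: ksign_def)

lemma ksign_scaleR_right: "(x :: 'a :: real_algebra_1) * (-1) ^ n = ksign n *\<^sub>R x"
  by (cases "even n") (auto simp: ksign_def)

section \<open>Words, their parities and exchanges of adjacent letters\<close>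

lemma wpar_simps [simp]: "wpar [] = 0" "wpar (a # w) = par a + wpar w" "wpar (u @ w) = wpar u + wpar w"
  by (auto simp: wpar_def)

lemma wpar_mset: "mset u = mset w \<Longrightarrow> wpar u = wpar w"
  unfolding wpar_def by (metis mset_map sum_mset_sum_list)

text \<open>Positions out of range leave the word unchanged, so that involutivity and invariance of
  the multiset hold without side conditions.\<close>

fun swp :: "nat \<Rightarrow> 'b list \<Rightarrow> 'b list" where
  "swp 0 (a # b # w) = b # a # w"
| "swp (Suc i) (a # w) = a # swp i w"
| "swp i w = w"

lemma swp_swp [simp]: "swp i (swp i w) = w"
  by (induction i w rule: swp.induct) auto

lemma mset_swp [simp]: "mset (swp i w) = mset w"
  by (induction i w rule: swp.induct) auto

lemma set_swp [simp]: "set (swp i w) = set w"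
  by (metis mset_swp set_mset_mset)

lemma length_swp [simp]: "length (swp i w) = length w"
  by (metis mset_swp size_mset)

lemma distinct_swp [simp]: "distinct (swp i w) = distinct w"
  by (rule mset_eq_imp_distinct_iff) simp

lemma wpar_swp [simp]: "wpar (swp i w) = wpar w"
  by (rule wpar_mset) simp

lemma map_swp: "map f (swp i w) = swp i (map f w)"
  by (induction i w rule: swp.induct) auto

lemma swp_append [simp]: "swp (length xs) (xs @ a # b # ys) = xs @ b # a # ys"
  by (induction xs) auto

lemma nth_swp [simp]:
  "Suc i < length w \<Longrightarrow> swp i w ! i = w ! Suc i"
  "Suc i < length w \<Longrightarrow> swp i w ! Suc i = w ! i"
  by (induct i w rule: swp.induct) auto

lemma nth_swp_other: "j \<noteq> i \<Longrightarrow> j \<noteq> Suc i \<Longrightarrow> swp i w ! j = w ! j"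
proof (induction i w arbitrary: j rule: swp.induct)
  case (1 a b w)
  then show ?case by (cases j; cases "j - 1") auto
next
  case (2 i a w)
  then show ?case by (cases j) auto
qed auto

lemma nth_swp_transpose:
  assumes "Suc i < length w"
  shows "swp i w ! j = w ! Transposition.transpose i (Suc i) j"
  using assms by (cases "j = i \<or> j = Suc i") (auto simp: nth_swp_other)

lemma split_at_pair:
  assumes "Suc i < length w"
  shows "w = take i w @ [w ! i, w ! Suc i] @ drop (Suc (Suc i)) w"
  using assms by (metis Cons_nth_drop_Suc Suc_lessD append_Cons append_Nil append_take_drop_id)

lemma swp_split:
  assumes "Suc i < length w"
  obtains xs a b ys where "w = xs @ a # b # ys" "swp i w = xs @ b # a # ys" "i = length xs"
    "w ! i = a" "w ! Suc i = b"
proof -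
  define xs ys where "xs = take i w" and "ys = drop (Suc (Suc i)) w"
  have w: "w = xs @ w ! i # w ! Suc i # ys" and len: "length xs = i"
    using split_at_pair[OF assms] assms by (auto simp: xs_def ys_def)
  have "swp i w = xs @ w ! Suc i # w ! i # ys"
    by (subst w) (use len swp_append in metis)
  with w len show thesis by (intro that) auto
qed

lemma drop_swp: "drop m (swp (m + i) w) = swp i (drop m w)"
proof (induction m arbitrary: w)
  case (Suc m)
  then show ?case by (cases w) auto
qed auto

lemma take_swp_add: "take m (swp (m + i) w) = take m w"
proof (induction m arbitrary: w)
  case (Suc m)
  then show ?case by (cases w) auto
qed auto

lemma take_swp:
  assumes "Suc i < j" "j \<le> length w"
  shows "take j (swp i w) = swp i (take j w)"
  using assms
proof (induction i w arbitrary: j rule: swp.induct)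
  case (1 a b w)
  then obtain j' where "j = Suc (Suc j')" by (metis less_imp_Suc_add add_Suc)
  then show ?case by simp
next
  case (2 i a w)
  then show ?case by (cases j) auto
qed auto

lemma drop_swp_lt:
  assumes "Suc i < j"
  shows "drop j (swp i w) = drop j w"
  using assms
proof (induction i w arbitrary: j rule: swp.induct)
  case (1 a b w)
  then obtain j' where "j = Suc (Suc j')" by (metis less_imp_Suc_add add_Suc)
  then show ?case by simp
next
  case (2 i a w)
  then show ?case by (cases j) auto
qed auto

text \<open>The first letter of the target is carried to the front by adjacent exchanges, and the
  rest is sorted behind it. The prefix \<open>pre\<close> of letters already placed is what the
  induction generalises over.\<close>

lemma adjacent_swaps_induct:
  assumes "mset xs = mset ys" "R xs"
    and "\<And>us a b vs. R (us @ a # b # vs) \<Longrightarrow> R (us @ b # a # vs)"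
  shows "R ys"
proof -
  have move: "R (pre @ x # us @ vs)" if "R (pre @ us @ x # vs)" for pre us vs x
    using that
  proof (induction us arbitrary: vs rule: rev_induct)
    case (snoc y us)
    from assms(3)[of "pre @ us" y x vs] snoc.prems have "R (pre @ us @ x # y # vs)" by simp
    from snoc.IH[OF this] show ?case by simp
  qed simp
  have "R (pre @ ys)" if "mset xs = mset ys" "R (pre @ xs)" for pre
    using that
  proof (induction ys arbitrary: pre xs)
    case (Cons y ys)
    then have "y \<in> set xs"
      by (metis list.set_intros(1) set_mset_mset)
    then obtain us vs where xs: "xs = us @ y # vs" by (meson split_list)
    with Cons.prems have "R (pre @ us @ y # vs)" by simp
    from move[OF this] have "R ((pre @ [y]) @ us @ vs)" by simp
    moreover have "mset (us @ vs) = mset ys" using Cons.prems xs by simp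
    ultimately show ?case using Cons.IH[of "us @ vs" "pre @ [y]"] by simp
  qed simp
  from this[of "[]"] assms(1,2) show ?thesis by simp
qed

text \<open>The letters outside \<open>cs\<close> are moved to the end and replaced one at a time; a word over
  \<open>cs\<close> either is a rearrangement of \<open>cs\<close> or has a repeated letter.\<close>

lemma reduce_to_word:
  assumes swap: "\<And>us a b vs. R (us @ a # b # vs) \<Longrightarrow> R (us @ b # a # vs)"
    and base: "R cs"
    and rep: "\<And>a w. length w + 2 = length cs \<Longrightarrow> set (a # w) \<subseteq> set cs \<Longrightarrow> R (a # a # w)"
    and step: "\<And>w b. Suc (length w) = length cs \<Longrightarrow> set (b # w) \<subseteq> L \<Longrightarrow>
        (\<And>c. c \<in> set cs \<Longrightarrow> R (w @ [c])) \<Longrightarrow> R (w @ [b])"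
    and "distinct cs" "set cs \<subseteq> L" "length w = length cs" "set w \<subseteq> L"
  shows "R w"
  using assms(7,8)
proof (induction "length (filter (\<lambda>x. x \<notin> set cs) w)" arbitrary: w rule: less_induct)
  case less
  have perm: "R ys \<Longrightarrow> mset ys = mset xs \<Longrightarrow> R xs" for xs ys
    by (rule adjacent_swaps_induct[of ys xs R]) (auto intro: swap)
  show ?case
  proof (cases "set w \<subseteq> set cs")
    case True
    show ?thesis
    proof (cases "distinct w")
      case True
      have "set w = set cs"
        using \<open>set w \<subseteq> set cs\<close> True less.prems(1) \<open>distinct cs\<close>
        by (metis List.finite_set card_subset_eq distinct_card)
      then have "mset cs = mset w"
        using True \<open>distinct cs\<close> by (metis set_eq_iff_mset_eq_distinct)
      then show ?thesis using perm base by blast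
    next
      case False
      then obtain xs ys zs a where w: "w = xs @ [a] @ ys @ [a] @ zs"
        using not_distinct_decomp by blast
      have "R (a # a # xs @ ys @ zs)"
        by (rule rep) (use w less.prems(1) \<open>set w \<subseteq> set cs\<close> in auto)
      then show ?thesis by (rule perm) (simp add: w)
    qed
  next
    case False
    then obtain b where b: "b \<in> set w" "b \<notin> set cs" by blast
    then obtain us vs where w: "w = us @ b # vs" by (meson split_list)
    have "R ((us @ vs) @ [b])"
    proof (rule step)
      fix c assume "c \<in> set cs"
      then show "R ((us @ vs) @ [c])"
        using w less.prems b \<open>set cs \<subseteq> L\<close> by (intro less.hyps) auto
    qed (use w less.prems in auto)
    then show ?thesis by (rule perm) (simp add: w)
  qed
qed

subsection \<open>Signs of rearrangements\<close>

text \<open>The Koszul sign of a rearrangement \<open>l\<close> of objects \<open>i\<close> of parity \<open>q i\<close>; for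
  \<open>q = (\<lambda>_. 0)\<close> it is the ordinary sign.\<close>

primrec sg :: "(nat \<Rightarrow> nat) \<Rightarrow> nat list \<Rightarrow> real" where
  "sg q [] = 1"
| "sg q (x # xs) = (\<Prod>y\<in>set xs. if y < x then - ksign (q x * q y) else 1) * sg q xs"

text \<open>Only the pair \<open>a\<close>, \<open>b\<close> changes its relative order; every other
  comparison contributes the same factor to both sides.\<close>

lemma sg_swap:
  "distinct (xs @ a # b # ys) \<Longrightarrow>
    sg q (xs @ b # a # ys) = - ksign (q a * q b) * sg q (xs @ a # b # ys)"
proof (induction xs)
  case Nil
  define P where "P x = (\<Prod>y\<in>set ys. if y < x then - ksign (q x * q y) else 1)" for x
  have *: "sg q (x # y # ys) = (if y < x then - ksign (q x * q y) else 1) * (P x * (P y * sg q ys))"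
    if "x \<noteq> y" "x \<notin> set ys" "y \<notin> set ys" for x y
    using that by (simp add: mult.assoc P_def)
  consider "a < b" | "b < a" using Nil by force
  then have "sg q (b # a # ys) = - ksign (q a * q b) * sg q (a # b # ys)"
  proof cases
    case 1
    then have "sg q (b # a # ys) = - ksign (q b * q a) * (P b * (P a * sg q ys))"
      and "sg q (a # b # ys) = P a * (P b * sg q ys)"
      using *[of a b] *[of b a] Nil by auto
    then show ?thesis by (simp only: mult.commute[of "q b"] mult.left_commute[of "P b"])
  next
    case 2
    then have "sg q (b # a # ys) = P b * (P a * sg q ys)"
      and "sg q (a # b # ys) = - ksign (q a * q b) * (P a * (P b * sg q ys))"
      using *[of a b] *[of b a] Nil by auto
    then show ?thesis by (simp only: mult.left_commute[of "P b"]) simp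
  qed
  then show ?case by simp
next
  case (Cons x xs)
  have "set (xs @ b # a # ys) = set (xs @ a # b # ys)" by auto
  with Cons show ?case by (simp del: set_append)
qed

lemma sg_swp:
  "distinct l \<Longrightarrow> Suc i < length l \<Longrightarrow> sg q (swp i l) = - ksign (q (l ! i) * q (l ! Suc i)) * sg q l"
  using sg_swap by (metis swp_split)

text \<open>Here two labels are exchanged, whereas \<open>sg_swap\<close> exchanges two positions.
  No label lies between \<open>i\<close> and \<open>Suc i\<close>, so only the comparison of these
  two with each other is affected. This is the sign needed when the underlying word, and not the
  permutation, is modified.\<close>

lemma sg_transpose:
  fixes i :: nat
  assumes "distinct l"
  defines "\<tau> \<equiv> Transposition.transpose i (Suc i)"
  shows "sg (q \<circ> \<tau>) l =
    (if i \<in> set l \<and> Suc i \<in> set l then - ksign (q i * q (Suc i)) else 1) * sg q (map \<tau> l)"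
  using assms(1)
proof (induction l)
  case (Cons x xs)
  define f where "f y = (if y < x then - ksign (q (\<tau> x) * q (\<tau> y)) else 1)" for y
  define g where "g y = (if \<tau> y < \<tau> x then - ksign (q (\<tau> x) * q (\<tau> y)) else 1)" for y
  define c where "c = (if i \<in> set xs \<and> Suc i \<in> set xs then - ksign (q i * q (Suc i)) else 1)"
  define d where "d = (if i \<in> set (x # xs) \<and> Suc i \<in> set (x # xs) then - ksign (q i * q (Suc i)) else 1)"
  have inj: "inj_on \<tau> S" for S by (simp add: \<tau>_def)
  have fg: "f y = g y" if "y \<noteq> x" "\<not> (x = i \<and> y = Suc i)" "\<not> (x = Suc i \<and> y = i)" for y
    using that by (auto simp: f_def g_def \<tau>_def Transposition.transpose_def)
  have key: "prod f (set xs) * c = d * prod g (set xs)"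
  proof (cases "(x = i \<and> Suc i \<in> set xs) \<or> (x = Suc i \<and> i \<in> set xs)")
    case True
    define z where "z = (if x = i then Suc i else i)"
    have z: "z \<in> set xs" using True by (auto simp: z_def)
    have "prod f (set xs) = f z * prod f (set xs - {z})"
      and "prod g (set xs) = g z * prod g (set xs - {z})"
      using z by (auto simp: prod.remove)
    moreover have "prod f (set xs - {z}) = prod g (set xs - {z})"
      by (rule prod.cong[OF refl], rule fg) (use Cons.prems True z_def in auto)
    moreover have "c = 1" using True Cons.prems by (auto simp: c_def)
    moreover have "d = - ksign (q i * q (Suc i))" using True by (auto simp: d_def)
    moreover have "f z = - ksign (q i * q (Suc i)) * g z"
      using True by (auto simp: f_def g_def z_def \<tau>_def mult.commute)
    ultimately show ?thesis by simp
  next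
    case False
    have "prod f (set xs) = prod g (set xs)"
      by (rule prod.cong[OF refl], rule fg) (use Cons.prems False in auto)
    moreover have "c = d" using False by (auto simp: c_def d_def)
    ultimately show ?thesis by simp
  qed
  have "sg (q \<circ> \<tau>) (x # xs) = prod f (set xs) * (c * sg q (map \<tau> xs))"
    using Cons.IH Cons.prems unfolding sg.simps o_apply f_def c_def by auto
  also have "\<dots> = d * (prod g (set xs) * sg q (map \<tau> xs))"
    using key by (simp add: mult.assoc[symmetric])
  also have "prod g (set xs) = (\<Prod>y\<in>set (map \<tau> xs). if y < \<tau> x then - ksign (q (\<tau> x) * q y) else 1)"
    by (simp add: prod.reindex[OF inj] g_def)
  finally show ?case by (simp add: d_def)
qed simp

lemma sg_upt [simp]: "sg q [0..<k] = 1"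
proof -
  have "sg q [j..<k] = 1" if "j \<le> k" for j
    using that by (induction rule: inc_induct) (auto simp: upt_conv_Cons intro!: prod.neutral)
  from this[of 0] show ?thesis by simp
qed

lemma permutations_of_set_swp [simp]: "swp i l \<in> permutations_of_set S \<longleftrightarrow> l \<in> permutations_of_set S"
  by (simp add: permutations_of_set_def)

lemma sum_permutations_swp:
  "(\<Sum>l\<in>permutations_of_set S. f (swp i l)) = (\<Sum>l\<in>permutations_of_set S. f l)"
  by (rule sum.reindex_bij_witness[of _ "swp i" "swp i"]) auto

lemma sum_permutations_transpose:
  assumes "Suc i < k"
  shows "(\<Sum>l\<in>permutations_of_set {..<k}. f (map (Transposition.transpose i (Suc i)) l)) =
    (\<Sum>l\<in>permutations_of_set {..<k}. f l)"
proof -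
  have "map (Transposition.transpose i (Suc i)) l \<in> permutations_of_set {..<k}"
    if "l \<in> permutations_of_set {..<k}" for l
  proof -
    have "Transposition.transpose i (Suc i) ` {..<k} = {..<k}"
      using assms by (intro Transposition.transpose_image_eq) auto
    with that show ?thesis
      by (auto simp: permutations_of_set_def distinct_map)
  qed
  then show ?thesis
    by (intro sum.reindex_bij_witness[of _ "map (Transposition.transpose i (Suc i))" "map (Transposition.transpose i (Suc i))"])
       (auto simp: o_def)
qed

lemma permutations_induct [consumes 1, case_names base swap]:
  assumes "l \<in> permutations_of_set {..<k}" "R [0..<k]"
    and "\<And>i l. Suc i < k \<Longrightarrow> l \<in> permutations_of_set {..<k} \<Longrightarrow> R l \<Longrightarrow> R (swp i l)"
  shows "R l"
proof -
  have "l \<in> permutations_of_set {..<k} \<and> R l"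
  proof (rule adjacent_swaps_induct[of "[0..<k]"])
    show "mset [0..<k] = mset l"
      using assms(1) set_eq_iff_mset_eq_distinct[of "[0..<k]" l]
      by (auto simp: permutations_of_set_def lessThan_atLeast0)
    show "[0..<k] \<in> permutations_of_set {..<k} \<and> R [0..<k]"
      using assms(2) by (auto simp: permutations_of_set_def)
    fix us vs :: "nat list" and a b
    assume *: "us @ a # b # vs \<in> permutations_of_set {..<k} \<and> R (us @ a # b # vs)"
    have "length (us @ a # b # vs) = k"
      using * by (metis card_lessThan length_finite_permutations_of_set)
    then have "R (swp (length us) (us @ a # b # vs))"
      using * by (intro assms(3)) auto
    moreover have "swp (length us) (us @ a # b # vs) \<in> permutations_of_set {..<k}"
      using * unfolding permutations_of_set_swp by blast
    ultimately show "us @ b # a # vs \<in> permutations_of_set {..<k} \<and> R (us @ b # a # vs)"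
      unfolding swp_append by blast
  qed
  then show ?thesis by blast
qed

subsection \<open>Superalgebras and the tensor algebra\<close>

locale superalgebra =
  fixes A :: "nat \<Rightarrow> 'a::real_algebra_1 set"
  assumes superalgebra: "comm_superalgebra A"
begin

lemma A_subspace: "subspace (A p)"
  using superalgebra unfolding comm_superalgebra_def by (elim conjE) (rule spec)

lemmas A_0 [simp] = subspace_0[OF A_subspace]
lemmas A_add = subspace_add[OF A_subspace]
lemmas A_diff = subspace_diff[OF A_subspace]
lemmas A_scaleR = subspace_scale[OF A_subspace]
lemmas A_sum = subspace_sum[OF A_subspace]

lemma A_1 [simp]: "1 \<in> A 0"
  using superalgebra unfolding comm_superalgebra_def by (elim conjE)

lemma A_cong:
  assumes "even p = even q"
  shows "A p = A q"
proof -
  have step: "A (r + 2) = A r" for r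
    using superalgebra unfolding comm_superalgebra_def by (elim conjE) (rule spec)
  have *: "A (r + 2 * k) = A r" for r k
  proof (induction k)
    case (Suc k)
    have "A (r + 2 * Suc k) = A ((r + 2 * k) + 2)" by simp
    then show ?case by (simp only: step Suc)
  qed simp
  have "A (r mod 2 + 2 * (r div 2)) = A (r mod 2)" for r by (rule *)
  then have "A r = A (r mod 2)" for r by (simp only: mod_mult_div_eq)
  moreover have "p mod 2 = q mod 2" using assms by presburger
  ultimately show ?thesis by metis
qed

lemma
  assumes "x \<in> A p" "y \<in> A q"
  shows A_mult: "x * y \<in> A (p + q)"
    and A_commute: "x * y = ksign (p * q) *\<^sub>R (y * x)"
proof -
  have "\<forall>p q. \<forall>x\<in>A p. \<forall>y\<in>A q. x * y \<in> A (p + q) \<and> x * y = (-1) ^ (p * q) * (y * x)"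
    using superalgebra unfolding comm_superalgebra_def by (elim conjE)
  from this[rule_format, OF assms]
  show "x * y \<in> A (p + q)" "x * y = ksign (p * q) *\<^sub>R (y * x)"
    unfolding ksign_scaleR by blast+
qed

lemma A_decomp: obtains y z where "y \<in> A 0" "z \<in> A 1" "x = y + z"
proof -
  have "\<forall>x. \<exists>y\<in>A 0. \<exists>z\<in>A 1. x = y + z"
    using superalgebra unfolding comm_superalgebra_def by (elim conjE)
  then show thesis using that by blast
qed

lemma A_even_commute: "x \<in> A 0 \<Longrightarrow> x * y = y * x"
proof -
  assume x: "x \<in> A 0"
  obtain u v where "u \<in> A 0" "v \<in> A 1" "y = u + v"
    by (rule A_decomp)
  with x A_commute[of x 0 u 0] A_commute[of x 0 v 1] show ?thesis
    by (simp add: distrib_left distrib_right)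
qed

lemma A_decomp_unique:
  assumes "y + z = y' + z'" "y \<in> A 0" "z \<in> A 1" "y' \<in> A 0" "z' \<in> A 1"
  shows "y = y'" "z = z'"
proof -
  have "y - y' = z' - z" using assms(1) by (simp add: algebra_simps)
  moreover have "y - y' \<in> A 0" "z' - z \<in> A 1" using assms A_diff by auto
  moreover have "A 0 \<inter> A 1 = {0}"
    using superalgebra unfolding comm_superalgebra_def by (elim conjE)
  ultimately have "y - y' = 0" "z' - z = 0" by (metis IntI singletonD)+
  then show "y = y'" "z = z'" by auto
qed

lemma koszul_decomp:
  assumes "y \<in> A 0" "z \<in> A 1"
  shows "koszul A p (y + z) = y + ksign p *\<^sub>R z"
  unfolding koszul_def ksign_scaleR
proof (rule the_equality)
  fix x' assume "\<exists>y'\<in>A 0. \<exists>z'\<in>A 1. y + z = y' + z' \<and> x' = y' + ksign p *\<^sub>R z'"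
  then obtain y' z' where "y' \<in> A 0" "z' \<in> A 1" "y + z = y' + z'" "x' = y' + ksign p *\<^sub>R z'"
    by blast
  with A_decomp_unique[of y z y' z'] assms show "x' = y + ksign p *\<^sub>R z" by simp
qed (use assms in blast)

lemma koszul_homogeneous:
  assumes "x \<in> A q"
  shows "koszul A p x = ksign (p * q) *\<^sub>R x"
proof (cases "even q")
  case True
  then have "x \<in> A 0" using assms A_cong[of q 0] by auto
  from koszul_decomp[OF this, of 0] show ?thesis
    using True by (simp add: ksign_if)
next
  case False
  then have "x \<in> A 1" using assms A_cong[of q 1] by auto
  from koszul_decomp[OF _ this, of 0] show ?thesis
    using False by (simp add: ksign_if)
qed

lemma koszul_0 [simp]: "koszul A p 0 = 0"
  using koszul_homogeneous[of 0 0 p] by simp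

lemma koszul_1 [simp]: "koszul A p 1 = 1"
  using koszul_homogeneous[of 1 0 p] by simp

lemma koszul_zero [simp]: "koszul A 0 x = x"
  by (rule A_decomp[of x]) (simp add: koszul_decomp)

lemma koszul_add: "koszul A p (x + y) = koszul A p x + koszul A p y"
proof -
  obtain x0 x1 y0 y1 where *: "x0 \<in> A 0" "x1 \<in> A 1" "x = x0 + x1" "y0 \<in> A 0" "y1 \<in> A 1" "y = y0 + y1"
    by (metis A_decomp)
  have "x + y = (x0 + y0) + (x1 + y1)" using * by simp
  with * koszul_decomp[of "x0 + y0" "x1 + y1" p] show ?thesis
    by (simp add: A_add koszul_decomp algebra_simps)
qed

lemma koszul_scaleR: "koszul A p (r *\<^sub>R x) = r *\<^sub>R koszul A p x"
proof -
  obtain x0 x1 where *: "x0 \<in> A 0" "x1 \<in> A 1" "x = x0 + x1" by (metis A_decomp)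
  with koszul_decomp[of "r *\<^sub>R x0" "r *\<^sub>R x1" p] show ?thesis
    by (simp add: A_scaleR koszul_decomp algebra_simps)
qed

lemma koszul_sum: "koszul A p (sum f S) = (\<Sum>i\<in>S. koszul A p (f i))"
  by (induction S rule: infinite_finite_induct) (auto simp: koszul_add)

text \<open>\<open>koszul A p\<close> is the \<open>p\<close>-th power of the parity automorphism.
  Its multiplicativity and the composition law \<open>koszul_koszul\<close> are exactly what
  associativity of the tensor product requires.\<close>

lemma koszul_mult: "koszul A p (x * y) = koszul A p x * koszul A p y"
proof -
  obtain x0 x1 y0 y1 where *: "x0 \<in> A 0" "x1 \<in> A 1" "x = x0 + x1" "y0 \<in> A 0" "y1 \<in> A 1" "y = y0 + y1"
    by (metis A_decomp)
  have "x0 * y0 \<in> A (0 + 0)" "x0 * y1 \<in> A (0 + 1)" "x1 * y0 \<in> A (1 + 0)" "x1 * y1 \<in> A (1 + 1)"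
    using * A_mult by blast+
  then have m: "x0 * y0 + x1 * y1 \<in> A 0" "x0 * y1 + x1 * y0 \<in> A 1"
    using A_cong[of "1 + 1" 0] by (auto intro: A_add)
  have "x * y = (x0 * y0 + x1 * y1) + (x0 * y1 + x1 * y0)"
    using * by (simp add: algebra_simps)
  then have "koszul A p (x * y) = (x0 * y0 + x1 * y1) + ksign p *\<^sub>R (x0 * y1 + x1 * y0)"
    using koszul_decomp[OF m] by simp
  then show ?thesis
    using * by (simp add: koszul_decomp algebra_simps)
qed

lemma koszul_koszul: "koszul A p (koszul A q x) = koszul A (p + q) x"
proof -
  obtain x0 x1 where *: "x0 \<in> A 0" "x1 \<in> A 1" "x = x0 + x1" by (metis A_decomp)
  with koszul_decomp[of x0 "ksign q *\<^sub>R x1" p] show ?thesis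
    by (simp add: A_scaleR koszul_decomp ksign_add)
qed

end

section \<open>The tensor algebra as a ring\<close>

locale superspace = superalgebra A for A :: "nat \<Rightarrow> 'a::real_algebra_1 set" +
  fixes n m :: nat
begin

abbreviation "TA \<equiv> tensor_algebra A n m"
abbreviation "EI \<equiv> exterior_ideal A n m"
abbreviation "EA \<equiv> exterior_algebra A n m"
abbreviation "ix \<equiv> indices n m"

lemma TA_carrier: "p \<in> carrier TA \<longleftrightarrow> finite {w. p w \<noteq> 0} \<and> (\<forall>w. p w \<noteq> 0 \<longrightarrow> set w \<subseteq> ix)"
  and TA_add: "p \<oplus>\<^bsub>TA\<^esub> q = (\<lambda>w. p w + q w)"
  and TA_zero: "\<zero>\<^bsub>TA\<^esub> = (\<lambda>w. 0)"
  and TA_one: "\<one>\<^bsub>TA\<^esub> = (\<lambda>w. if w = [] then 1 else 0)"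
  and TA_mult: "p \<otimes>\<^bsub>TA\<^esub> q =
    (\<lambda>w. \<Sum>i\<le>length w. p (take i w) * koszul A (wpar (take i w)) (q (drop i w)))"
  by (auto simp: tensor_algebra_def)

lemma TA_add_closed: "p \<in> carrier TA \<Longrightarrow> q \<in> carrier TA \<Longrightarrow> (\<lambda>w. p w + q w) \<in> carrier TA"
proof -
  assume *: "p \<in> carrier TA" "q \<in> carrier TA"
  have sub: "{w. p w + q w \<noteq> 0} \<subseteq> {w. p w \<noteq> 0} \<union> {w. q w \<noteq> 0}" by auto
  then have "finite {w. p w + q w \<noteq> 0}"
    by (rule finite_subset) (use * in \<open>simp add: TA_carrier\<close>)
  with * sub show ?thesis unfolding TA_carrier by blast
qed

lemma TA_uminus_closed: "p \<in> carrier TA \<Longrightarrow> (\<lambda>w. - p w) \<in> carrier TA"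
  unfolding TA_carrier by auto

lemma TA_mult_nonzero:
  assumes "(p \<otimes>\<^bsub>TA\<^esub> q) w \<noteq> 0"
  obtains u v where "w = u @ v" "p u \<noteq> 0" "q v \<noteq> 0"
proof -
  obtain i where "p (take i w) * koszul A (wpar (take i w)) (q (drop i w)) \<noteq> 0"
    using assms unfolding TA_mult by (meson sum.not_neutral_contains_not_neutral)
  then show thesis by (intro that[of "take i w" "drop i w"]) auto
qed

lemma TA_mult_closed:
  assumes "p \<in> carrier TA" "q \<in> carrier TA"
  shows "p \<otimes>\<^bsub>TA\<^esub> q \<in> carrier TA"
  unfolding TA_carrier
proof safe
  have "{w. (p \<otimes>\<^bsub>TA\<^esub> q) w \<noteq> 0} \<subseteq> (\<lambda>(u, v). u @ v) ` ({u. p u \<noteq> 0} \<times> {v. q v \<noteq> 0})"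
    by (auto elim!: TA_mult_nonzero)
  then show "finite {w. (p \<otimes>\<^bsub>TA\<^esub> q) w \<noteq> 0}"
    by (rule finite_subset) (use assms in \<open>auto simp: TA_carrier\<close>)
next
  fix w x assume w: "(p \<otimes>\<^bsub>TA\<^esub> q) w \<noteq> 0" "x \<in> set w"
  from w(1) show "x \<in> ix"
    by (rule TA_mult_nonzero) (use assms w(2) in \<open>auto simp: TA_carrier\<close>)
qed

text \<open>Both sides are sums over the ways to cut \<open>w\<close> into three consecutive pieces.
  In either bracketing the third coefficient passes the first two pieces, and the second passes the
  first.\<close>

lemma TA_mult_assoc: "(p \<otimes>\<^bsub>TA\<^esub> q) \<otimes>\<^bsub>TA\<^esub> r = p \<otimes>\<^bsub>TA\<^esub> (q \<otimes>\<^bsub>TA\<^esub> r)"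
proof
  fix w :: "sindex list"
  define F where "F i j = p (take i w) * (koszul A (wpar (take i w)) (q (take j (drop i w)))
    * koszul A (wpar (take (i + j) w)) (r (drop (i + j) w)))" for i j
  have "((p \<otimes>\<^bsub>TA\<^esub> q) \<otimes>\<^bsub>TA\<^esub> r) w = (\<Sum>j\<le>length w. \<Sum>i\<le>j. F i (j - i))"
    unfolding TA_mult
  proof (intro sum.cong refl)
    fix j assume "j \<in> {..length w}"
    then show "(\<Sum>i\<le>length (take j w). p (take i (take j w)) *
         koszul A (wpar (take i (take j w))) (q (drop i (take j w)))) *
       koszul A (wpar (take j w)) (r (drop j w)) = (\<Sum>i\<le>j. F i (j - i))"
      by (auto simp: sum_distrib_right F_def min_def take_drop mult.assoc intro!: sum.cong)
  qed
  also have "\<dots> = (\<Sum>i\<le>length w. \<Sum>j\<le>length w - i. F i j)"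
  proof -
    \<comment> \<open>On the left \<open>j\<close> is the end of the second piece, on the right it
      is the length of that piece; \<open>i\<close> is the end of the first piece in both.\<close>
    have "(\<Sum>j\<le>N. \<Sum>i\<le>j. F i (j - i)) = (\<Sum>i\<le>N. \<Sum>j\<le>N - i. F i j)" for N
      by (simp add: sum.Sigma)
         (rule sum.reindex_bij_witness[of _ "\<lambda>(i, j). (i + j, i)" "\<lambda>(j, i). (i, j - i)"]; auto)
    then show ?thesis .
  qed
  also have "\<dots> = (p \<otimes>\<^bsub>TA\<^esub> (q \<otimes>\<^bsub>TA\<^esub> r)) w"
    unfolding TA_mult
  proof (intro sum.cong refl)
    fix i assume "i \<in> {..length w}"
    then have i: "i \<le> length w" by simp
    have "wpar (take i w) + wpar (take j (drop i w)) = wpar (take (i + j) w)" for j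
      by (simp add: take_add)
    then show "(\<Sum>j\<le>length w - i. F i j) = p (take i w) * koszul A (wpar (take i w))
         (\<Sum>ia\<le>length (drop i w). q (take ia (drop i w)) *
            koszul A (wpar (take ia (drop i w))) (r (drop ia (drop i w))))"
      by (simp add: F_def koszul_sum koszul_mult koszul_koszul sum_distrib_left add.commute)
  qed
  finally show "((p \<otimes>\<^bsub>TA\<^esub> q) \<otimes>\<^bsub>TA\<^esub> r) w = (p \<otimes>\<^bsub>TA\<^esub> (q \<otimes>\<^bsub>TA\<^esub> r)) w" .
qed

lemma TA_ring: "ring TA"
proof (rule ringI)
  show "abelian_group TA"
  proof (rule abelian_groupI)
    fix p assume "p \<in> carrier TA"
    then show "\<exists>q\<in>carrier TA. q \<oplus>\<^bsub>TA\<^esub> p = \<zero>\<^bsub>TA\<^esub>"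
      by (intro bexI[of _ "\<lambda>w. - p w"] TA_uminus_closed) (auto simp: TA_add TA_zero)
  next
    show "\<zero>\<^bsub>TA\<^esub> \<in> carrier TA" by (auto simp: TA_carrier TA_zero)
  qed (auto simp: TA_add TA_zero add_ac TA_add_closed)
  have one: "\<one>\<^bsub>TA\<^esub> \<in> carrier TA" by (auto simp: TA_carrier TA_one)
  show "monoid TA"
  proof (rule monoidI)
    fix p assume "p \<in> carrier TA"
    show "\<one>\<^bsub>TA\<^esub> \<otimes>\<^bsub>TA\<^esub> p = p"
    proof
      fix w
      have "(\<one>\<^bsub>TA\<^esub> \<otimes>\<^bsub>TA\<^esub> p) w = (\<Sum>i\<le>length w. if i = 0 then p w else 0)"
        unfolding TA_mult TA_one by (intro sum.cong) auto
      then show "(\<one>\<^bsub>TA\<^esub> \<otimes>\<^bsub>TA\<^esub> p) w = p w" by simp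
    qed
    show "p \<otimes>\<^bsub>TA\<^esub> \<one>\<^bsub>TA\<^esub> = p"
    proof
      fix w
      have "(p \<otimes>\<^bsub>TA\<^esub> \<one>\<^bsub>TA\<^esub>) w = (\<Sum>i\<le>length w. if i = length w then p w else 0)"
        unfolding TA_mult TA_one by (intro sum.cong) auto
      then show "(p \<otimes>\<^bsub>TA\<^esub> \<one>\<^bsub>TA\<^esub>) w = p w" by simp
    qed
  qed (auto simp: TA_mult_closed TA_mult_assoc one)
next
  fix p q r
  show "(p \<oplus>\<^bsub>TA\<^esub> q) \<otimes>\<^bsub>TA\<^esub> r = p \<otimes>\<^bsub>TA\<^esub> r \<oplus>\<^bsub>TA\<^esub> q \<otimes>\<^bsub>TA\<^esub> r"
    by (auto simp: TA_add TA_mult ring_distribs sum.distrib)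
  show "r \<otimes>\<^bsub>TA\<^esub> (p \<oplus>\<^bsub>TA\<^esub> q) = r \<otimes>\<^bsub>TA\<^esub> p \<oplus>\<^bsub>TA\<^esub> r \<otimes>\<^bsub>TA\<^esub> q"
    by (auto simp: TA_add TA_mult koszul_add ring_distribs sum.distrib)
qed

sublocale TA: ring TA
  by (rule TA_ring)

definition single :: "sindex list \<Rightarrow> 'a \<Rightarrow> sindex list \<Rightarrow> 'a" where
  "single u x = (\<lambda>w. if w = u then x else 0)"

lemma single_closed [simp]: "set u \<subseteq> ix \<Longrightarrow> single u x \<in> carrier TA"
  by (auto simp: single_def TA_carrier)

lemma single_mult:
  "(single u x \<otimes>\<^bsub>TA\<^esub> p) w =
    (if take (length u) w = u then x * koszul A (wpar u) (p (drop (length u) w)) else 0)"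
proof -
  have "(single u x \<otimes>\<^bsub>TA\<^esub> p) w =
      (\<Sum>i\<le>length w. if i = length u then
        (if take (length u) w = u then x * koszul A (wpar u) (p (drop (length u) w)) else 0) else 0)"
    unfolding TA_mult single_def by (intro sum.cong) auto
  also have "\<dots> = (if length u \<le> length w then
        (if take (length u) w = u then x * koszul A (wpar u) (p (drop (length u) w)) else 0) else 0)"
    by simp
  also have "\<dots> = (if take (length u) w = u then x * koszul A (wpar u) (p (drop (length u) w)) else 0)"
    by (metis nat_le_linear take_all)
  finally show ?thesis .
qed

lemma single_mult_single:
  "single u x \<otimes>\<^bsub>TA\<^esub> single v y = single (u @ v) (x * koszul A (wpar u) y)"
proof
  fix w
  show "(single u x \<otimes>\<^bsub>TA\<^esub> single v y) w = single (u @ v) (x * koszul A (wpar u) y) w"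
    unfolding single_mult by (auto simp: single_def) (metis append_take_drop_id)
qed

text \<open>Elements are built up from their own monomials. The coefficients added are those of the
  fixed \<open>p\<close>, so facts about the support of \<open>p\<close>, such as its degree, are
  available in the step.\<close>

lemma carrier_induct [consumes 1, case_names zero add]:
  assumes "p \<in> carrier TA" "R (\<lambda>w. 0)"
    and "\<And>q u. q \<in> carrier TA \<Longrightarrow> set u \<subseteq> ix \<Longrightarrow> p u \<noteq> 0 \<Longrightarrow> q u = 0 \<Longrightarrow> R q \<Longrightarrow>
        R (\<lambda>w. single u (p u) w + q w)"
  shows "R p"
proof -
  have fin: "finite {w. p w \<noteq> 0}" and sub: "\<And>w. p w \<noteq> 0 \<Longrightarrow> set w \<subseteq> ix"
    using assms(1) by (auto simp: TA_carrier)
  have "R (\<lambda>w. if w \<in> S then p w else 0)" if "finite S" "S \<subseteq> {w. p w \<noteq> 0}" for S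
    using that
  proof (induction rule: finite_induct)
    case empty
    then show ?case using assms(2) by simp
  next
    case (insert u S)
    let ?q = "\<lambda>w. if w \<in> S then p w else 0"
    have "?q \<in> carrier TA"
      using insert sub by (auto simp: TA_carrier)
    then have "R (\<lambda>w. single u (p u) w + ?q w)"
      using insert sub by (intro assms(3)) auto
    also have "(\<lambda>w. single u (p u) w + ?q w) = (\<lambda>w. if w \<in> insert u S then p w else 0)"
      using insert by (auto simp: single_def)
    finally show ?case .
  qed
  from this[OF fin order_refl] have "R (\<lambda>w. if w \<in> {w. p w \<noteq> 0} then p w else 0)" .
  also have "(\<lambda>w. if w \<in> {w. p w \<noteq> 0} then p w else 0) = p" by auto
  finally show ?thesis .
qed

end

subsection \<open>The exterior ideal and antisymmetrization\<close>

text \<open>The shape of a relator placed at positions \<open>i\<close> and \<open>i + 1\<close> of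
  longer words. Words too short to have these two positions must get coefficient 0, since otherwise
  every tensor of low degree would qualify.\<close>

definition adj_symmetric :: "nat \<Rightarrow> (sindex list \<Rightarrow> 'a::real_vector) \<Rightarrow> bool" where
  "adj_symmetric i p \<longleftrightarrow> (\<forall>w. length w < i + 2 \<longrightarrow> p w = 0) \<and>
     (\<forall>w. Suc i < length w \<longrightarrow> p w = ksign (par (w ! i) * par (w ! Suc i)) *\<^sub>R p (swp i w))"

lemma adj_symmetric_zero: "adj_symmetric i p \<Longrightarrow> length w < i + 2 \<Longrightarrow> p w = 0"
  unfolding adj_symmetric_def by blast

lemma adj_symmetric_swp: "adj_symmetric i p \<Longrightarrow> Suc i < length w \<Longrightarrow>
    p w = ksign (par (w ! i) * par (w ! Suc i)) *\<^sub>R p (swp i w)"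
  unfolding adj_symmetric_def by blast

text \<open>The action of an adjacent transposition on coefficients that becomes trivial in the
  exterior algebra; super-antisymmetric tensors are its common fixed points.\<close>

definition flip :: "nat \<Rightarrow> (sindex list \<Rightarrow> 'a::real_vector) \<Rightarrow> sindex list \<Rightarrow> 'a" where
  "flip i p w = - (ksign (par (w ! i) * par (w ! Suc i)) *\<^sub>R p (swp i w))"

definition super_antisymmetric :: "(sindex list \<Rightarrow> 'a::real_vector) \<Rightarrow> bool" where
  "super_antisymmetric p \<longleftrightarrow> (\<forall>i w. Suc i < length w \<longrightarrow> p w = flip i p w)"

lemma super_antisymmetricD: "super_antisymmetric p \<Longrightarrow> Suc i < length w \<Longrightarrow> p w = flip i p w"
  unfolding super_antisymmetric_def by blast

text \<open>The signed action of a whole permutation, given by its list of values \<open>l\<close>.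
  The parities entering the sign are those of the letters of \<open>w\<close> that are being
  moved.\<close>

definition rearr :: "nat list \<Rightarrow> (sindex list \<Rightarrow> 'a::real_vector) \<Rightarrow> sindex list \<Rightarrow> 'a" where
  "rearr l p w = sg (\<lambda>i. par (w ! i)) l *\<^sub>R p (map ((!) w) l)"

definition Alt :: "(sindex list \<Rightarrow> 'a::real_vector) \<Rightarrow> sindex list \<Rightarrow> 'a" where
  "Alt p w = (\<Sum>l\<in>permutations_of_set {..<length w}. rearr l p w)"

lemma perm_length: "l \<in> permutations_of_set {..<k} \<Longrightarrow> length l = k"
  by (metis card_lessThan length_finite_permutations_of_set)

lemma perm_mset_map_nth:
  assumes "l \<in> permutations_of_set {..<length w}"
  shows "mset (map ((!) w) l) = mset w"
proof -
  have "mset l = mset [0..<length w]"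
    using assms set_eq_iff_mset_eq_distinct[of "[0..<length w]" l]
    by (auto simp: permutations_of_set_def lessThan_atLeast0)
  then have "mset (map ((!) w) l) = mset (map ((!) w) [0..<length w])"
    by (simp only: mset_map)
  then show ?thesis by (simp only: map_nth)
qed

text \<open>The sign gained by \<open>sg\<close> at positions \<open>i\<close> and
  \<open>i + 1\<close> of \<open>l\<close> involves the parities of the two letters that stand there
  in the rearranged word, which is the sign in \<open>flip\<close>. Statements about arbitrary
  permutations are thereby reduced to flips.\<close>

lemma rearr_swp:
  assumes "Suc i < length w" "l \<in> permutations_of_set {..<length w}"
  shows "rearr (swp i l) p w = rearr l (flip i p) w"
proof -
  have l: "distinct l" "length l = length w"
    using assms(2) perm_length by (auto simp: permutations_of_set_def)
  then show ?thesis
    using assms(1) by (simp add: rearr_def flip_def sg_swp map_swp mult.commute)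
qed

lemma rearr_uminus: "rearr l (\<lambda>w. - p w) w = - rearr l p w"
  by (simp add: rearr_def)

lemma Alt_add: "Alt (\<lambda>w. p w + q w) w = Alt p w + Alt q w"
  by (simp add: Alt_def rearr_def scaleR_add_right sum.distrib)

text \<open>The terms of \<open>l\<close> and \<open>swp i l\<close> are opposite, so reindexing
  gives \<open>Alt p w = - Alt p w\<close>; over the reals 2 can be cancelled.\<close>

lemma Alt_adj_symmetric:
  assumes "adj_symmetric i p"
  shows "Alt p w = 0"
proof (cases "Suc i < length w")
  case False
  have "rearr l p w = 0" if "l \<in> permutations_of_set {..<length w}" for l
  proof -
    have "length (map ((!) w) l) < i + 2" using False perm_length[OF that] by simp
    then have "p (map ((!) w) l) = 0"
      by (rule adj_symmetric_zero[OF assms])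
    then show ?thesis by (simp add: rearr_def)
  qed
  then show ?thesis by (simp add: Alt_def)
next
  case True
  have "rearr (swp i l) p w = - rearr l p w" if l: "l \<in> permutations_of_set {..<length w}" for l
  proof -
    have "flip i p v = - p v" if "length v = length w" for v
    proof -
      have "p v = ksign (par (v ! i) * par (v ! Suc i)) *\<^sub>R p (swp i v)"
        by (rule adj_symmetric_swp[OF assms]) (use that True in simp)
      then show ?thesis unfolding flip_def by (rule arg_cong[where f = uminus, OF sym])
    qed
    then have "rearr l (flip i p) w = rearr l (\<lambda>w. - p w) w"
      using perm_length[OF l] by (simp add: rearr_def)
    then show ?thesis
      unfolding rearr_uminus by (simp add: rearr_swp[OF True l])
  qed
  then have "(\<Sum>l\<in>permutations_of_set {..<length w}. rearr (swp i l) p w) = - Alt p w"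
    by (simp add: Alt_def sum_negf)
  then have "Alt p w = - Alt p w"
    unfolding sum_permutations_swp[of "\<lambda>l. rearr l p w"] Alt_def by simp
  then have "Alt p w + Alt p w = - Alt p w + Alt p w" by (rule arg_cong)
  then have "Alt p w + Alt p w = 0" by (simp only: add.left_inverse)
  then show ?thesis by (simp flip: scaleR_2)
qed

text \<open>Exchanging two letters of the word amounts to exchanging two labels in each permutation,
  which permutes the summands and multiplies all of them by the sign of
  \<open>sg_transpose\<close>.\<close>

lemma Alt_super_antisymmetric: "super_antisymmetric (Alt p)"
  unfolding super_antisymmetric_def
proof safe
  fix i and w :: "sindex list" assume i: "Suc i < length w"
  let ?\<tau> = "Transposition.transpose i (Suc i)" and ?P = "permutations_of_set {..<length w}"
  let ?s = "ksign (par (w ! i) * par (w ! Suc i))"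
  have "rearr l p (swp i w) = - (?s *\<^sub>R rearr (map ?\<tau> l) p w)" if l: "l \<in> ?P" for l
  proof -
    have nth: "swp i w ! j = w ! ?\<tau> j" for j by (rule nth_swp_transpose[OF i])
    have "distinct l" "i \<in> set l" "Suc i \<in> set l"
      using l i by (auto simp: permutations_of_set_def)
    then have "sg (\<lambda>j. par (swp i w ! j)) l = - ?s * sg (\<lambda>j. par (w ! j)) (map ?\<tau> l)"
      using sg_transpose[of l "\<lambda>j. par (w ! j)" i] by (simp add: nth o_def)
    moreover have "map ((!) (swp i w)) l = map ((!) w) (map ?\<tau> l)" by (simp add: nth)
    ultimately show ?thesis by (simp only: rearr_def mult_minus_left scaleR_minus_left scaleR_scaleR)
  qed
  then have "Alt p (swp i w) = (\<Sum>l\<in>?P. - (?s *\<^sub>R rearr (map ?\<tau> l) p w))"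
    by (simp add: Alt_def)
  also have "\<dots> = - (?s *\<^sub>R (\<Sum>l\<in>?P. rearr (map ?\<tau> l) p w))"
    by (simp add: sum_negf scaleR_sum_right)
  also have "(\<Sum>l\<in>?P. rearr (map ?\<tau> l) p w) = Alt p w"
    using sum_permutations_transpose[OF i, of "\<lambda>l. rearr l p w"] by (simp add: Alt_def)
  finally show "Alt p w = flip i (Alt p) w" by (simp add: flip_def)
qed

lemma Alt_eq_fact_scaleR:
  assumes "super_antisymmetric p"
  shows "Alt p w = fact (length w) *\<^sub>R p w"
proof -
  have "rearr l p w = p w" if "l \<in> permutations_of_set {..<length w}" for l
    using that
  proof (induction rule: permutations_induct)
    case base
    show ?case by (simp add: rearr_def map_nth)
  next
    case (swap i l)
    have "flip i p v = p v" if "length v = length w" for v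
      using super_antisymmetricD[OF assms, of i v] swap(1) that by simp
    then have "rearr l (flip i p) w = rearr l p w"
      using perm_length[OF swap(2)] by (simp add: rearr_def)
    then show ?case unfolding rearr_swp[OF swap(1,2)] swap(3) .
  qed
  then show ?thesis
    by (simp add: Alt_def sum_constant_scaleR)
qed

lemma vector_tensor_basis [simp]:
  "vector_tensor (basis_vector a :: _ \<Rightarrow> 'a::zero_neq_one) w = (if w = [a] then 1 else 0)"
  by (auto simp: vector_tensor_def basis_vector_def split: list.splits)

section \<open>An ideal of sums of adjacently supersymmetric tensors containing the exterior
  ideal\<close>

context superspace
begin

text \<open>The position \<open>i\<close> may differ from summand to summand. Being an ideal that
  contains the relators, this set bounds the exterior ideal from above in a form on which
  \<open>Alt\<close> is easy to evaluate.\<close>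

inductive_set symspan :: "(sindex list \<Rightarrow> 'a) set" where
  symspan_zero: "(\<lambda>w. 0) \<in> symspan"
| symspan_step: "p \<in> carrier TA \<Longrightarrow> adj_symmetric i p \<Longrightarrow> q \<in> symspan \<Longrightarrow> (\<lambda>w. p w + q w) \<in> symspan"

lemma symspan_single: "p \<in> carrier TA \<Longrightarrow> adj_symmetric i p \<Longrightarrow> p \<in> symspan"
  using symspan_step[OF _ _ symspan_zero] by simp

lemma symspan_carrier: "p \<in> symspan \<Longrightarrow> p \<in> carrier TA"
proof (induction rule: symspan.induct)
  case symspan_zero
  then show ?case using TA.zero_closed by (simp add: TA_zero)
qed (auto intro: TA_add_closed)

lemma symspan_add: "p \<in> symspan \<Longrightarrow> q \<in> symspan \<Longrightarrow> (\<lambda>w. p w + q w) \<in> symspan"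
proof (induction rule: symspan.induct)
  case (symspan_step p i r)
  then have "(\<lambda>w. p w + (r w + q w)) \<in> symspan"
    by (intro symspan.symspan_step[of p i]) auto
  then show ?case by (simp only: add.assoc)
qed simp

lemma symspan_uminus: "p \<in> symspan \<Longrightarrow> (\<lambda>w. - p w) \<in> symspan"
proof (induction rule: symspan.induct)
  case (symspan_step p i r)
  have "adj_symmetric i (\<lambda>w. - p w)"
    unfolding adj_symmetric_def
  proof safe
    fix w :: "sindex list" assume "Suc i < length w"
    from adj_symmetric_swp[OF symspan_step(2) this]
    show "- p w = ksign (par (w ! i) * par (w ! Suc i)) *\<^sub>R - p (swp i w)" by (simp only: scaleR_minus_right)
  qed (simp add: adj_symmetric_zero[OF symspan_step(2)])
  then have "(\<lambda>w. - p w + - r w) \<in> symspan"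
    using symspan_step by (intro symspan.symspan_step[of _ i] TA_uminus_closed) auto
  then show ?case by simp
qed (simp add: symspan_zero)

lemma TA_uminus: "p \<in> carrier TA \<Longrightarrow> \<ominus>\<^bsub>TA\<^esub> p = (\<lambda>w. - p w)"
  by (rule TA.minus_equality) (auto simp: TA_add TA_zero TA_uminus_closed)

text \<open>The prefix \<open>u\<close> shifts the symmetric positions by its length; its Koszul
  sign depends on \<open>u\<close> alone and is the same before and after the exchange.\<close>

lemma adj_symmetric_single_mult:
  assumes "adj_symmetric i p"
  shows "adj_symmetric (length u + i) (single u x \<otimes>\<^bsub>TA\<^esub> p)"
  unfolding adj_symmetric_def
proof safe
  fix w :: "sindex list" assume "length w < length u + i + 2"
  then have "length (drop (length u) w) < i + 2" by simp
  then have "p (drop (length u) w) = 0" by (rule adj_symmetric_zero[OF assms])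
  then show "(single u x \<otimes>\<^bsub>TA\<^esub> p) w = 0" by (simp add: single_mult)
next
  fix w :: "sindex list" assume w: "Suc (length u + i) < length w"
  let ?v = "drop (length u) w"
  have "Suc i < length ?v" using w by simp
  then have "p ?v = ksign (par (?v ! i) * par (?v ! Suc i)) *\<^sub>R p (swp i ?v)"
    by (rule adj_symmetric_swp[OF assms])
  also have "?v ! i = w ! (length u + i)" using w by simp
  also have "?v ! Suc i = w ! Suc (length u + i)" using w by simp
  finally show "(single u x \<otimes>\<^bsub>TA\<^esub> p) w = ksign (par (w ! (length u + i)) * par (w ! Suc (length u + i))) *\<^sub>R
      (single u x \<otimes>\<^bsub>TA\<^esub> p) (swp (length u + i) w)"
    by (simp add: single_mult drop_swp take_swp_add koszul_scaleR)
qed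

text \<open>A cut of the word at or before position \<open>i + 1\<close> leaves a left piece on
  which \<open>p\<close> vanishes. A later cut leaves both letters in the left piece, where
  \<open>p\<close> is symmetric.\<close>

lemma adj_symmetric_mult:
  assumes "adj_symmetric i p"
  shows "adj_symmetric i (p \<otimes>\<^bsub>TA\<^esub> y)"
  unfolding adj_symmetric_def
proof safe
  fix w :: "sindex list" assume "length w < i + 2"
  then have "length (take j w) < i + 2" for j by simp
  then have "p (take j w) = 0" for j by (rule adj_symmetric_zero[OF assms])
  then show "(p \<otimes>\<^bsub>TA\<^esub> y) w = 0" by (simp add: TA_mult)
next
  fix w :: "sindex list" assume w: "Suc i < length w"
  let ?s = "ksign (par (w ! i) * par (w ! Suc i))" and ?v = "swp i w"
  have "p (take j w) * koszul A (wpar (take j w)) (y (drop j w)) =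
     ?s *\<^sub>R (p (take j ?v) * koszul A (wpar (take j ?v)) (y (drop j ?v)))" if "j \<le> length w" for j
  proof (cases "Suc i < j")
    case True
    then have "p (take j w) = ?s *\<^sub>R p (swp i (take j w))"
      using adj_symmetric_swp[OF assms, of "take j w"] that by simp
    then show ?thesis
      using True that by (simp add: take_swp drop_swp_lt)
  next
    case False
    then have "length (take j u) < i + 2" for u :: "sindex list" by simp
    then have "p (take j u) = 0" for u by (rule adj_symmetric_zero[OF assms])
    then show ?thesis by simp
  qed
  then show "(p \<otimes>\<^bsub>TA\<^esub> y) w = ?s *\<^sub>R (p \<otimes>\<^bsub>TA\<^esub> y) (swp i w)"
    by (simp add: TA_mult scaleR_sum_right)
qed

lemma TA_distrib_right: "(\<lambda>w. p w + q w) \<otimes>\<^bsub>TA\<^esub> r = (\<lambda>w. (p \<otimes>\<^bsub>TA\<^esub> r) w + (q \<otimes>\<^bsub>TA\<^esub> r) w)"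
  by (simp add: TA_mult distrib_right sum.distrib)

lemma TA_distrib_left: "r \<otimes>\<^bsub>TA\<^esub> (\<lambda>w. p w + q w) = (\<lambda>w. (r \<otimes>\<^bsub>TA\<^esub> p) w + (r \<otimes>\<^bsub>TA\<^esub> q) w)"
  by (simp add: TA_mult koszul_add distrib_left sum.distrib)

lemma TA_mult_zero: "(\<lambda>w. 0) \<otimes>\<^bsub>TA\<^esub> r = (\<lambda>w. 0)" "r \<otimes>\<^bsub>TA\<^esub> (\<lambda>w. 0) = (\<lambda>w. 0)"
  by (simp_all add: TA_mult)

text \<open>The words of \<open>x\<close> may have different lengths and then shift the symmetric
  positions differently, so \<open>x\<close> is split into monomials. On the right no shift occurs
  and no splitting is made.\<close>

lemma symspan_mult_left:
  assumes "x \<in> carrier TA" "p \<in> symspan"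
  shows "x \<otimes>\<^bsub>TA\<^esub> p \<in> symspan"
  using assms(2)
proof (induction rule: symspan.induct)
  case (symspan_step p i q)
  have "x \<otimes>\<^bsub>TA\<^esub> p \<in> symspan"
    using assms(1)
  proof (induction rule: carrier_induct)
    case (add y u)
    have "single u (x u) \<otimes>\<^bsub>TA\<^esub> p \<in> symspan"
      using add symspan_step
      by (intro symspan_single[OF _ adj_symmetric_single_mult] TA_mult_closed) auto
    with add.IH show ?case by (simp add: TA_distrib_right symspan_add)
  qed (simp add: TA_mult_zero symspan_zero)
  with symspan_step.IH show ?case by (simp add: TA_distrib_left symspan_add)
qed (simp add: TA_mult_zero symspan_zero)

lemma symspan_mult_right:
  assumes "x \<in> carrier TA" "p \<in> symspan"
  shows "p \<otimes>\<^bsub>TA\<^esub> x \<in> symspan"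
  using assms(2)
proof (induction rule: symspan.induct)
  case (symspan_step p i q)
  have "p \<otimes>\<^bsub>TA\<^esub> x \<in> symspan"
    using assms(1) symspan_step by (intro symspan_single[OF _ adj_symmetric_mult] TA_mult_closed) auto
  with symspan_step.IH show ?case by (simp add: TA_distrib_right symspan_add)
qed (simp add: TA_mult_zero symspan_zero)

lemma symspan_ideal: "ideal symspan TA"
proof (rule idealI[OF TA_ring])
  show "subgroup symspan (add_monoid TA)"
  proof (rule TA.add.subgroupI)
    show "symspan \<subseteq> carrier TA" using symspan_carrier by blast
    show "symspan \<noteq> {}" using symspan_zero by blast
    show "\<ominus>\<^bsub>TA\<^esub> p \<in> symspan" if "p \<in> symspan" for p
      using that by (simp add: TA_uminus symspan_carrier symspan_uminus)
    show "p \<oplus>\<^bsub>TA\<^esub> q \<in> symspan" if "p \<in> symspan" "q \<in> symspan" for p q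
      using that by (simp add: TA_add symspan_add)
  qed
qed (auto intro: symspan_mult_left symspan_mult_right)

lemma vector_tensor_closed:
  assumes "v \<in> homogeneous_vectors A n m p"
  shows "vector_tensor v \<in> carrier TA"
proof -
  have ix: "finite ix" by (simp add: indices_def)
  have *: "set w \<subseteq> ix \<and> w \<in> (\<lambda>a. [a]) ` ix" if nz: "vector_tensor v w \<noteq> 0" for w
  proof -
    obtain a where "w = [a]" "v a \<noteq> 0"
      using nz by (cases w; cases "tl w") (auto simp: vector_tensor_def)
    moreover from this have "a \<in> ix" using assms by (auto simp: homogeneous_vectors_def)
    ultimately show ?thesis by auto
  qed
  then have "{w. vector_tensor v w \<noteq> 0} \<subseteq> (\<lambda>a. [a]) ` ix" by blast
  then have "finite {w. vector_tensor v w \<noteq> 0}"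
    by (rule finite_subset) (use ix in simp)
  with * show ?thesis by (simp add: TA_carrier)
qed

lemma vector_tensor_mult:
  "(vector_tensor v \<otimes>\<^bsub>TA\<^esub> p) w = (case w of [] \<Rightarrow> 0 | a # y \<Rightarrow> v a * koszul A (par a) (p y))"
proof (cases w)
  case Nil
  then show ?thesis by (simp add: TA_mult vector_tensor_def)
next
  case (Cons a y)
  have "(vector_tensor v \<otimes>\<^bsub>TA\<^esub> p) w = (\<Sum>i\<le>length w. if i = 1 then v a * koszul A (par a) (p y) else 0)"
    unfolding TA_mult
  proof (intro sum.cong refl)
    fix i assume "i \<in> {..length w}"
    then have len: "length (take i w) = i" by simp
    show "vector_tensor v (take i w) * koszul A (wpar (take i w)) (p (drop i w)) =
         (if i = 1 then v a * koszul A (par a) (p y) else 0)"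
    proof (cases "i = 1")
      case False
      then have "take i w \<noteq> [b]" for b
        using len by (metis One_nat_def length_Cons list.size(3))
      then have "vector_tensor v (take i w) = 0"
        by (auto simp: vector_tensor_def split: list.split)
      then show ?thesis using False by simp
    qed (use Cons in \<open>simp add: vector_tensor_def\<close>)
  qed
  then show ?thesis using Cons by (simp only: sum.delta finite_atMost) simp
qed

lemma scalar_tensor_single: "scalar_tensor x = single [] x"
  by (simp add: scalar_tensor_def single_def)

lemma scalar_tensor_mult: "(scalar_tensor x \<otimes>\<^bsub>TA\<^esub> p) = (\<lambda>w. x * p w)"
  by (rule ext) (simp add: scalar_tensor_single single_mult)

lemma homogeneous_vectors_A: "v \<in> homogeneous_vectors A n m p \<Longrightarrow> v a \<in> A (p + par a)"
  unfolding homogeneous_vectors_def by (cases "a \<in> ix") auto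

text \<open>With \<open>c a b\<close> the coefficient of the first product at \<open>[a, b]\<close>,
  commuting \<open>w a\<close> past \<open>v b\<close> absorbs both the relator sign
  \<open>p * q\<close> and the Koszul sign of the second product. What remains of the latter is the
  exchanged term of \<open>c\<close>.\<close>

lemma relator_adj_symmetric:
  assumes v: "v \<in> homogeneous_vectors A n m p" and w: "w \<in> homogeneous_vectors A n m q"
  shows "adj_symmetric 0 (\<lambda>x. (vector_tensor v \<otimes>\<^bsub>TA\<^esub> vector_tensor w) x
    + (-1) ^ (p * q) * (vector_tensor w \<otimes>\<^bsub>TA\<^esub> vector_tensor v) x)" (is "adj_symmetric 0 ?r")
proof -
  define c where "c a b = ksign (par a * (q + par b)) *\<^sub>R (v a * w b)" for a b
  have r: "?r [a, b] = c a b + ksign (par a * par b) *\<^sub>R c b a" for a b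
  proof -
    have "w a * v b = ksign ((q + par a) * (p + par b)) *\<^sub>R (v b * w a)"
      by (rule A_commute) (use v w homogeneous_vectors_A in auto)
    moreover have "ksign (p * q) * (ksign (par a * (p + par b)) * ksign ((q + par a) * (p + par b)))
        = ksign (par a * par b) * ksign (par b * (q + par a))"
      unfolding ksign_add[symmetric] by (rule ksign_eq) auto
    ultimately show ?thesis
      using koszul_homogeneous[OF homogeneous_vectors_A[OF v]] koszul_homogeneous[OF homogeneous_vectors_A[OF w]]
      by (simp add: vector_tensor_mult ksign_scaleR c_def) (simp add: vector_tensor_def)
  qed
  have z: "?r x = 0" if "\<And>a b. x \<noteq> [a, b]" for x
  proof -
    have "(vector_tensor v \<otimes>\<^bsub>TA\<^esub> vector_tensor w) x = 0" for v w :: "sindex \<Rightarrow> 'a"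
    proof (cases x)
      case (Cons a y)
      then have "y \<noteq> [b]" for b using that by auto
      then have "vector_tensor w y = 0" by (auto simp: vector_tensor_def split: list.split)
      then show ?thesis using Cons by (simp add: vector_tensor_mult)
    qed (simp add: vector_tensor_mult)
    then show ?thesis by simp
  qed
  show ?thesis
    unfolding adj_symmetric_def
  proof (intro conjI allI impI)
    fix x :: "sindex list" assume "length x < 0 + 2"
    then show "?r x = 0" by (intro z) auto
  next
    fix x :: "sindex list" assume "Suc 0 < length x"
    then obtain a b y where x: "x = a # b # y" by (cases x; cases "tl x") auto
    show "?r x = ksign (par (x ! 0) * par (x ! Suc 0)) *\<^sub>R ?r (swp 0 x)"
    proof (cases "y = []")
      case True
      show ?thesis
        unfolding x True swp.simps r by (simp add: scaleR_add_right mult.commute)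
    next
      case False
      then have "?r x = 0" "?r (swp 0 x) = 0" using x by (auto intro!: z)
      then show ?thesis by (simp only: scaleR_zero_right)
    qed
  qed
qed

lemma relator_closed:
  assumes v: "v \<in> homogeneous_vectors A n m p" and w: "w \<in> homogeneous_vectors A n m q"
  shows "(vector_tensor v \<otimes>\<^bsub>TA\<^esub> vector_tensor w) \<oplus>\<^bsub>TA\<^esub>
      (scalar_tensor ((-1) ^ (p * q)) \<otimes>\<^bsub>TA\<^esub> (vector_tensor w \<otimes>\<^bsub>TA\<^esub> vector_tensor v)) \<in> carrier TA"
proof -
  have "scalar_tensor ((-1) ^ (p * q)) \<in> carrier TA" by (simp add: scalar_tensor_single)
  then show ?thesis
    using assms by (intro TA.add.m_closed TA_mult_closed) (auto intro: vector_tensor_closed)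
qed

lemma relators_carrier: "exterior_relators A n m \<subseteq> carrier TA"
  unfolding exterior_relators_def using relator_closed by blast

lemma relators_symspan: "exterior_relators A n m \<subseteq> symspan"
proof
  fix r assume "r \<in> exterior_relators A n m"
  then obtain p q v w where *: "v \<in> homogeneous_vectors A n m p" "w \<in> homogeneous_vectors A n m q"
    and r: "r = (vector_tensor v \<otimes>\<^bsub>TA\<^esub> vector_tensor w) \<oplus>\<^bsub>TA\<^esub>
      (scalar_tensor ((-1) ^ (p * q)) \<otimes>\<^bsub>TA\<^esub> (vector_tensor w \<otimes>\<^bsub>TA\<^esub> vector_tensor v))"
    unfolding exterior_relators_def by blast
  have "r \<in> carrier TA" unfolding r by (rule relator_closed[OF *])
  moreover have "adj_symmetric 0 r"
    using relator_adj_symmetric[OF *] unfolding r TA_add scalar_tensor_mult .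
  ultimately show "r \<in> symspan" by (rule symspan_single)
qed

lemma EI_ideal: "ideal EI TA"
  unfolding exterior_ideal_def by (rule TA.genideal_ideal[OF relators_carrier])

sublocale EI: ideal EI TA
  by (rule EI_ideal)

lemma EI_symspan: "EI \<subseteq> symspan"
  unfolding exterior_ideal_def by (rule TA.genideal_minimal[OF symspan_ideal relators_symspan])

lemma Alt_EI: "p \<in> EI \<Longrightarrow> Alt p w = 0"
proof -
  have "Alt p w = 0" if "p \<in> symspan" for p
    using that
  proof (induction rule: symspan.induct)
    case symspan_zero
    show ?case by (simp add: Alt_def rearr_def)
  qed (simp add: Alt_add Alt_adj_symmetric)
  then show "p \<in> EI \<Longrightarrow> Alt p w = 0" using EI_symspan by blast
qed

end

subsection \<open>Components of a multivector\<close>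

context superspace
begin

lemma EI_add: "p \<in> EI \<Longrightarrow> q \<in> EI \<Longrightarrow> (\<lambda>w. p w + q w) \<in> EI"
  using EI.a_closed[of p q] by (simp add: TA_add)

lemma EI_zero: "(\<lambda>w. 0) \<in> EI"
  using EI.zero_closed by (simp add: TA_zero)

lemma EI_scaleR: "p \<in> EI \<Longrightarrow> (\<lambda>w. r *\<^sub>R p w) \<in> EI"
proof -
  assume "p \<in> EI"
  then have "single [] (r *\<^sub>R 1) \<otimes>\<^bsub>TA\<^esub> p \<in> EI" by (intro EI.I_l_closed) auto
  moreover have "single [] (r *\<^sub>R 1) \<otimes>\<^bsub>TA\<^esub> p = (\<lambda>w. r *\<^sub>R p w)"
    by (rule ext) (simp add: single_mult)
  ultimately show ?thesis by simp
qed

lemma EI_sum: "(\<And>l. l \<in> S \<Longrightarrow> p l \<in> EI) \<Longrightarrow> (\<lambda>w. \<Sum>l\<in>S. p l w) \<in> EI"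
  by (induction S rule: infinite_finite_induct) (auto simp: EI_zero intro: EI_add)

definition H :: "nat \<Rightarrow> (sindex list \<Rightarrow> 'a) set" where
  "H k = {p \<in> carrier TA. \<forall>w. p w \<noteq> 0 \<longrightarrow> length w = k}"

lemma finite_indices [simp]: "finite ix"
  by (simp add: indices_def)

lemma finite_words [simp]: "finite (words n m k)"
  using finite_lists_length_eq[of ix k] by (simp add: words_def conj_commute)

lemma H_iff: "p \<in> H k \<longleftrightarrow> (\<forall>w. w \<notin> words n m k \<longrightarrow> p w = 0)"
proof
  assume "\<forall>w. w \<notin> words n m k \<longrightarrow> p w = 0"
  then have "{w. p w \<noteq> 0} \<subseteq> words n m k" by blast
  moreover from this have "finite {w. p w \<noteq> 0}" by (rule finite_subset) simp
  ultimately show "p \<in> H k" unfolding H_def TA_carrier words_def by blast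
qed (auto simp: H_def TA_carrier words_def)

lemma words_mset: "mset u = mset w \<Longrightarrow> u \<in> words n m k \<longleftrightarrow> w \<in> words n m k"
  unfolding words_def by (auto dest: mset_eq_setD mset_eq_length)

lemma words_swp [simp]: "swp i w \<in> words n m k \<longleftrightarrow> w \<in> words n m k"
  by (rule words_mset) simp

lemma flip_H: "p \<in> H k \<Longrightarrow> flip i p \<in> H k"
  by (simp add: H_iff flip_def)

lemma basis_vector_homogeneous:
  assumes "a \<in> ix"
  shows "basis_vector a \<in> homogeneous_vectors A n m (par a)"
proof -
  have "(1::'a) \<in> A (par a + par a)" using A_cong[of "par a + par a" 0] by simp
  then show ?thesis using assms by (auto simp: homogeneous_vectors_def basis_vector_def)
qed

lemma vector_tensor_basis_single: "vector_tensor (basis_vector a) = (single [a] 1 :: _ \<Rightarrow> 'a)"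
  by (rule ext) (simp add: single_def)

text \<open>The relator of the basis vectors \<open>a\<close> and \<open>b\<close>, multiplied by a
  monomial on either side.\<close>

lemma swap_basis_EI:
  assumes "set (us @ a # b # vs) \<subseteq> ix"
  shows "(\<lambda>w. single (us @ a # b # vs) x w
    + ksign (par a * par b) *\<^sub>R single (us @ b # a # vs) x w) \<in> EI"
proof -
  let ?r = "(\<lambda>w. single [a, b] 1 w + single [b, a] (ksign (par a * par b) *\<^sub>R 1) w)"
  have "?r = (vector_tensor (basis_vector a) \<otimes>\<^bsub>TA\<^esub> vector_tensor (basis_vector b)) \<oplus>\<^bsub>TA\<^esub>
        (scalar_tensor ((-1) ^ (par a * par b)) \<otimes>\<^bsub>TA\<^esub>
          (vector_tensor (basis_vector b) \<otimes>\<^bsub>TA\<^esub> vector_tensor (basis_vector a)))"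
    by (simp add: vector_tensor_basis_single single_mult_single scalar_tensor_mult TA_add ksign_scaleR)
       (auto simp: single_def)
  also have "\<dots> \<in> EI"
    unfolding exterior_ideal_def
    using basis_vector_homogeneous[of a] basis_vector_homogeneous[of b] assms
    by (intro subsetD[OF TA.genideal_self[OF relators_carrier]])
       (unfold exterior_relators_def, auto)
  finally have "?r \<in> EI" .
  then have "single us x \<otimes>\<^bsub>TA\<^esub> (?r \<otimes>\<^bsub>TA\<^esub> single vs 1) \<in> EI"
    using assms by (intro EI.I_l_closed EI.I_r_closed) auto
  moreover have "single us x \<otimes>\<^bsub>TA\<^esub> (?r \<otimes>\<^bsub>TA\<^esub> single vs 1) = (\<lambda>w. single (us @ a # b # vs) x w
      + single (us @ b # a # vs) (ksign (par a * par b) *\<^sub>R x) w)"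
    by (simp add: TA_distrib_left TA_distrib_right single_mult_single koszul_scaleR)
  ultimately show ?thesis by (simp add: single_def if_distrib cong: if_cong)
qed

text \<open>\<open>flip i\<close> is additive, so one monomial suffices; its flip is minus the
  signed monomial with the two letters exchanged, as in \<open>swap_basis_EI\<close>.\<close>

lemma flip_EI:
  assumes "p \<in> H k" "Suc i < k"
  shows "(\<lambda>w. p w - flip i p w) \<in> EI"
proof -
  have "p \<in> carrier TA" and len: "p u \<noteq> 0 \<Longrightarrow> length u = k" for u
    using assms by (auto simp: H_def)
  from this(1) show ?thesis
  proof (induction rule: carrier_induct)
    case zero
    show ?case by (simp add: flip_def EI_zero)
  next
    case (add q u)
    obtain xs a b ys where u: "swp i u = xs @ b # a # ys" "u = xs @ a # b # ys" "i = length xs"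
      using swp_split[of i u] len[of u] add assms(2) by metis
    have set: "set (xs @ a # b # ys) \<subseteq> ix" using add(2) u(2) by simp
    define s where "s = single u (p u)"
    have "s w - flip i s w = s w + ksign (par a * par b) *\<^sub>R single (swp i u) (p u) w" for w
    proof (cases "swp i w = u")
      case True
      have "w = swp i u" unfolding True[symmetric] by simp
      then have w: "w = xs @ b # a # ys" by (simp only: u(1))
      then show ?thesis using True u
        by (simp add: flip_def s_def single_def nth_append mult.commute)
    next
      case False
      then have "w \<noteq> swp i u" by auto
      then show ?thesis using False by (simp add: flip_def s_def single_def)
    qed
    then have "(\<lambda>w. s w - flip i s w) = (\<lambda>w. s w + ksign (par a * par b) *\<^sub>R single (swp i u) (p u) w)"
      by (rule ext)
    also have "\<dots> \<in> EI"
      using swap_basis_EI[OF set, of "p u"] by (simp only: s_def u(1) flip: u(2))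
    finally have "(\<lambda>w. s w - flip i s w) \<in> EI" .
    from EI_add[OF this add.IH] show ?case
      by (simp add: flip_def scaleR_add_right algebra_simps s_def)
  qed
qed

text \<open>The guard on the length matters: for a word of another length,
  \<open>map ((!) w) l\<close> is not a rearrangement of \<open>w\<close>, so the difference would
  be meaningless there.\<close>

lemma rearr_EI:
  assumes "l \<in> permutations_of_set {..<k}" "p \<in> H k"
  shows "(\<lambda>w. if length w = k then p w - rearr l p w else 0) \<in> EI"
  using assms
proof (induction arbitrary: p rule: permutations_induct)
  case base
  have "(if length w = k then p w - rearr [0..<k] p w else 0) = 0" for w
    using map_nth[of w] by (auto simp: rearr_def)
  then show ?case by (simp add: EI_zero)
next
  case (swap i l)
  \<comment> \<open>The difference is telescoped through \<open>flip i p\<close>. The induction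
    hypothesis is used for this other tensor, which is why \<open>p\<close> is kept
    arbitrary.\<close>
  have *: "(if length w = k then p w - rearr (swp i l) p w else 0)
      = (p w - flip i p w) + (if length w = k then flip i p w - rearr l (flip i p) w else 0)" for w
  proof (cases "length w = k")
    case True
    then show ?thesis using rearr_swp[of i w l p] swap by simp
  next
    case False
    then have "w \<notin> words n m k" by (auto simp: words_def)
    then have "p w = 0" "flip i p w = 0"
      using swap.prems flip_H[OF swap.prems, of i] by (auto simp: H_iff)
    then show ?thesis using False by simp
  qed
  show ?case unfolding *
    by (rule EI_add[OF flip_EI[OF swap.prems swap.hyps(1)] swap.IH[OF flip_H[OF swap.prems]]])
qed

lemma Alt_H:
  assumes "p \<in> H k"
  shows "Alt p \<in> H k"
  unfolding H_iff
proof safe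
  fix w assume w: "w \<notin> words n m k"
  have "p (map ((!) w) l) = 0" if "l \<in> permutations_of_set {..<length w}" for l
    using assms w words_mset[OF perm_mset_map_nth[OF that]] by (simp add: H_iff)
  then show "Alt p w = 0" by (simp add: Alt_def rearr_def)
qed

text \<open>The average of the differences in \<open>rearr_EI\<close> over all permutations.\<close>

lemma Alt_diff_EI:
  assumes "p \<in> H k"
  shows "(\<lambda>w. p w - (1 / fact k) *\<^sub>R Alt p w) \<in> EI"
proof -
  let ?P = "permutations_of_set {..<k}"
  have "(\<lambda>w. (1 / fact k) *\<^sub>R (\<Sum>l\<in>?P. if length w = k then p w - rearr l p w else 0)) \<in> EI"
    by (intro EI_scaleR EI_sum rearr_EI assms)
  moreover have "(1 / fact k) *\<^sub>R (\<Sum>l\<in>?P. if length w = k then p w - rearr l p w else 0)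
      = p w - (1 / fact k) *\<^sub>R Alt p w" for w
  proof (cases "length w = k")
    case True
    have "(\<Sum>l\<in>?P. p w) = fact k *\<^sub>R p w" by (simp add: sum_constant_scaleR del: sum_constant)
    then show ?thesis using True
      by (simp add: sum_subtractf Alt_def scaleR_diff_right)
  next
    case False
    then have "w \<notin> words n m k" by (auto simp: words_def)
    then have "p w = 0" "Alt p w = 0"
      using assms Alt_H[OF assms] by (auto simp: H_iff)
    then show ?thesis using False by simp
  qed
  ultimately show ?thesis by simp
qed

lemma super_antisymmetric_EI_zero:
  assumes "super_antisymmetric p" "p \<in> EI"
  shows "p = (\<lambda>w. 0)"
proof
  fix w
  have "fact (length w) *\<^sub>R p w = 0"
    using Alt_eq_fact_scaleR[OF assms(1), of w] Alt_EI[OF assms(2), of w] by simp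
  then show "p w = 0" by simp
qed

section \<open>Component families as super-antisymmetric representatives\<close>

sublocale ext: ring_hom_ring TA EA "ext_class A n m"
proof -
  have "ext_class A n m = (+>\<^bsub>TA\<^esub>) EI" by (rule ext) (simp add: ext_class_def)
  then show "ring_hom_ring TA EA (ext_class A n m)"
    using EI.rcos_ring_hom_ring by (simp add: exterior_algebra_def)
qed

lemma ext_class_eq_iff:
  assumes "p \<in> carrier TA" "q \<in> carrier TA"
  shows "ext_class A n m p = ext_class A n m q \<longleftrightarrow> (\<lambda>w. p w - q w) \<in> EI"
proof -
  have "p \<ominus>\<^bsub>TA\<^esub> q = (\<lambda>w. p w - q w)"
    using assms by (simp add: a_minus_def TA_uminus TA_add)
  then show ?thesis
    using TA.quotient_eq_iff_same_a_r_cos[OF EI_ideal assms] by (simp add: ext_class_def)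
qed

lemma wedge_foldr:
  assumes "\<And>v. v \<in> set vs \<Longrightarrow> vector_tensor v \<in> carrier TA"
  shows "wedge A n m vs = ext_class A n m
      (foldr (\<lambda>v p. vector_tensor v \<otimes>\<^bsub>TA\<^esub> p) vs \<one>\<^bsub>TA\<^esub>) \<and>
    foldr (\<lambda>v p. vector_tensor v \<otimes>\<^bsub>TA\<^esub> p) vs \<one>\<^bsub>TA\<^esub> \<in> carrier TA"
  using assms
proof (induction vs)
  case Nil
  then show ?case by (simp add: wedge_def)
next
  case (Cons v vs)
  then have IH: "wedge A n m vs = ext_class A n m
      (foldr (\<lambda>v p. vector_tensor v \<otimes>\<^bsub>TA\<^esub> p) vs \<one>\<^bsub>TA\<^esub>)"
    "foldr (\<lambda>v p. vector_tensor v \<otimes>\<^bsub>TA\<^esub> p) vs \<one>\<^bsub>TA\<^esub> \<in> carrier TA"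
    and v: "vector_tensor v \<in> carrier TA"
    by auto
  have "wedge A n m (v # vs) = ext_class A n m (vector_tensor v) \<otimes>\<^bsub>EA\<^esub> wedge A n m vs"
    by (simp add: wedge_def)
  then show ?case using IH v by (simp add: TA_mult_closed)
qed

lemma one_single: "\<one>\<^bsub>TA\<^esub> = single [] 1"
  by (auto simp: TA_one single_def)

lemma wedge_basis:
  assumes "set w \<subseteq> ix"
  shows "wedge A n m (map basis_vector w) = ext_class A n m (single w 1)"
proof -
  have "foldr (\<lambda>v p. vector_tensor v \<otimes>\<^bsub>TA\<^esub> p) (map basis_vector w) \<one>\<^bsub>TA\<^esub> = single w 1"
    by (induction w) (simp_all add: one_single vector_tensor_basis_single single_mult_single)
  then show ?thesis
    using wedge_foldr[of "map basis_vector w"] assms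
    by (fastforce simp: vector_tensor_basis_single)
qed

text \<open>A coefficient times a product of basis vectors is the class of a monomial, so the whole
  expansion is the class of the family \<open>t\<close> read as a tensor.\<close>

lemma expansion_eq:
  assumes "t \<in> H k"
  shows "finsum EA (\<lambda>w. ext_class A n m (scalar_tensor (t w)) \<otimes>\<^bsub>EA\<^esub> wedge A n m (map basis_vector w))
     (words n m k) = ext_class A n m t"
proof -
  have sum: "finsum EA (\<lambda>w. ext_class A n m (single w (t w))) S =
      ext_class A n m (\<lambda>v. if v \<in> S then t v else 0) \<and> (\<lambda>v. if v \<in> S then t v else 0) \<in> carrier TA"
    if "finite S" "S \<subseteq> words n m k" for S
    using that
  proof (induction rule: finite_induct)
    case empty
    show ?case using ext.hom_zero TA.zero_closed by (simp add: TA_zero)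
  next
    case (insert w S)
    let ?q = "\<lambda>v. if v \<in> S then t v else 0"
    have sc: "single v (t v) \<in> carrier TA" if "v \<in> insert w S" for v
      using insert that by (auto simp: words_def)
    have q: "?q \<in> carrier TA" and IH: "finsum EA (\<lambda>w. ext_class A n m (single w (t w))) S = ext_class A n m ?q"
      using insert by auto
    have eq: "(\<lambda>v. if v \<in> insert w S then t v else 0) = single w (t w) \<oplus>\<^bsub>TA\<^esub> ?q"
      using insert by (auto simp: TA_add single_def)
    have "finsum EA (\<lambda>w. ext_class A n m (single w (t w))) (insert w S)
        = ext_class A n m (single w (t w)) \<oplus>\<^bsub>EA\<^esub> ext_class A n m ?q"
      unfolding IH[symmetric] using insert sc by (intro ext.S.finsum_insert) auto
    also have "\<dots> = ext_class A n m (single w (t w) \<oplus>\<^bsub>TA\<^esub> ?q)"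
      using sc q by (intro ext.hom_add[symmetric]) auto
    finally show ?case
      unfolding eq using sc[of w] q by (auto intro: TA.add.m_closed)
  qed
  have "ext_class A n m (scalar_tensor (t w)) \<otimes>\<^bsub>EA\<^esub> wedge A n m (map basis_vector w)
      = ext_class A n m (single w (t w))" if "w \<in> words n m k" for w
  proof -
    have w: "set w \<subseteq> ix" using that by (simp add: words_def)
    then have "ext_class A n m (scalar_tensor (t w)) \<otimes>\<^bsub>EA\<^esub> wedge A n m (map basis_vector w)
        = ext_class A n m (single [] (t w) \<otimes>\<^bsub>TA\<^esub> single w 1)"
      by (simp add: wedge_basis scalar_tensor_single)
    then show ?thesis by (simp add: single_mult_single)
  qed
  then have "finsum EA (\<lambda>w. ext_class A n m (scalar_tensor (t w)) \<otimes>\<^bsub>EA\<^esub> wedge A n m (map basis_vector w))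
     (words n m k) = finsum EA (\<lambda>w. ext_class A n m (single w (t w))) (words n m k)"
    by (intro ext.S.finsum_cong') (auto simp: words_def)
  also have "\<dots> = ext_class A n m (\<lambda>v. if v \<in> words n m k then t v else 0)"
    by (intro conjunct1[OF sum]) auto
  also have "(\<lambda>v. if v \<in> words n m k then t v else 0) = t"
    using assms by (auto simp: H_iff)
  finally show ?thesis .
qed

text \<open>Components are recast as a representative of \<open>T\<close> in the tensor algebra.
  Existence becomes antisymmetrization of a representative, and uniqueness becomes the absence of
  nonzero super-antisymmetric tensors in the ideal.\<close>

lemma is_components_iff:
  "is_components A n m k T t \<longleftrightarrow>
    T = ext_class A n m t \<and> t \<in> H k \<and> super_antisymmetric t \<and> (\<forall>w. t w \<in> A (wpar w))"
proof -
  have sym: "(\<forall>xs a b ys. xs @ [a, b] @ ys \<in> words n m k \<longrightarrow>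
        t (xs @ [a, b] @ ys) = - ((-1) ^ (par a * par b) * t (xs @ [b, a] @ ys)))
      \<longleftrightarrow> super_antisymmetric t" (is "?L \<longleftrightarrow> _") if t: "t \<in> H k"
  proof
    assume L: ?L
    show "super_antisymmetric t"
      unfolding super_antisymmetric_def
    proof safe
      fix i and w :: "sindex list" assume i: "Suc i < length w"
      show "t w = flip i t w"
      proof (cases "w \<in> words n m k")
        case True
        obtain xs a b ys where w: "w = xs @ a # b # ys" "swp i w = xs @ b # a # ys"
            "w ! i = a" "w ! Suc i = b"
          using swp_split[OF i] by metis
        have "t w = - ((-1) ^ (par a * par b) * t (swp i w))"
          using L[rule_format, of xs a b ys] True w(1,2) by simp
        then show ?thesis using w(3,4) by (simp add: flip_def ksign_scaleR)
      next
        case False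
        then show ?thesis using t by (simp add: H_iff flip_def)
      qed
    qed
  next
    assume anti: "super_antisymmetric t"
    show ?L
    proof (intro allI impI)
      fix xs ys :: "sindex list" and a b
      show "t (xs @ [a, b] @ ys) = - ((-1) ^ (par a * par b) * t (xs @ [b, a] @ ys))"
        using super_antisymmetricD[OF anti, of "length xs" "xs @ a # b # ys"]
        by (simp add: flip_def ksign_scaleR nth_append)
    qed
  qed
  have H: "(\<forall>w. w \<notin> words n m k \<longrightarrow> t w = 0) \<longleftrightarrow> t \<in> H k" by (simp add: H_iff)
  have par: "(\<forall>w\<in>words n m k. t w \<in> A (wpar w)) \<longleftrightarrow> (\<forall>w. t w \<in> A (wpar w))" if "t \<in> H k"
  proof -
    have "t w \<in> A (wpar w)" if "w \<notin> words n m k" for w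
      using \<open>t \<in> H k\<close> that by (simp add: H_iff)
    then show ?thesis by blast
  qed
  show ?thesis
  proof (cases "t \<in> H k")
    case True
    show ?thesis
      unfolding is_components_def H sym[OF True] par[OF True] expansion_eq[OF True] using True by blast
  qed (simp add: is_components_def H)
qed

lemma is_components_unique:
  assumes "is_components A n m k T t" "is_components A n m k T t'"
  shows "t = t'"
proof -
  have "t \<in> carrier TA" "t' \<in> carrier TA" and eq: "ext_class A n m t = ext_class A n m t'"
    and as: "super_antisymmetric t" "super_antisymmetric t'"
    using assms by (auto simp: is_components_iff H_def)
  then have "(\<lambda>w. t w - t' w) \<in> EI" by (simp add: ext_class_eq_iff)
  moreover have "super_antisymmetric (\<lambda>w. t w - t' w)"
    unfolding super_antisymmetric_def
  proof safe
    fix i and w :: "sindex list" assume "Suc i < length w"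
    with as have "t w = flip i t w" "t' w = flip i t' w" by (auto intro: super_antisymmetricD)
    then show "t w - t' w = flip i (\<lambda>w. t w - t' w) w"
      unfolding flip_def scaleR_diff_right by simp
  qed
  ultimately have "(\<lambda>w. t w - t' w) = (\<lambda>w. 0)" by (intro super_antisymmetric_EI_zero)
  then show ?thesis by (auto simp: fun_eq_iff)
qed

lemma mv_components_eqI: "is_components A n m k T t \<Longrightarrow> mv_components A n m k T = t"
  unfolding mv_components_def by (rule the_equality) (auto intro: is_components_unique)

lemma components_exist:
  assumes "T \<in> even_multivectors A n m k"
  shows "is_components A n m k T (mv_components A n m k T)"
proof -
  obtain p where p: "p \<in> carrier TA" "\<And>w. p w \<noteq> 0 \<Longrightarrow> length w = k" "\<And>w. p w \<in> A (wpar w)"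
    and T: "T = ext_class A n m p"
    using assms unfolding even_multivectors_def by blast
  define t where "t = (\<lambda>w. (1 / fact k) *\<^sub>R Alt p w)"
  have pH: "p \<in> H k" using p by (simp add: H_def)
  have tH: "t \<in> H k" using Alt_H[OF pH] by (simp add: t_def H_iff)
  have "ext_class A n m p = ext_class A n m t"
    using pH tH Alt_diff_EI[OF pH] by (subst ext_class_eq_iff) (auto simp: H_def t_def)
  moreover have "super_antisymmetric t"
    unfolding super_antisymmetric_def
  proof safe
    fix i and w :: "sindex list" assume "Suc i < length w"
    with Alt_super_antisymmetric have "Alt p w = flip i (Alt p) w" by (rule super_antisymmetricD)
    then show "t w = flip i t w" unfolding flip_def t_def by (simp add: mult.commute)
  qed
  moreover have "t w \<in> A (wpar w)" for w
    unfolding t_def Alt_def rearr_def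
  proof (intro A_scaleR A_sum)
    fix l assume "l \<in> permutations_of_set {..<length w}"
    from wpar_mset[OF perm_mset_map_nth[OF this]] show "p (map ((!) w) l) \<in> A (wpar w)"
      using p(3)[of "map ((!) w) l"] by simp
  qed
  ultimately have "is_components A n m k T t"
    using T tH by (simp add: is_components_iff)
  then show ?thesis using mv_components_eqI by metis
qed

end

subsection \<open>Super-determinants with ordered columns\<close>

text \<open>The sign of moving row \<open>r\<close> to the front of the rows \<open>R\<close> taken
  in increasing order.\<close>

definition rsign :: "nat set \<Rightarrow> nat \<Rightarrow> real" where
  "rsign R r = ksign (card {s \<in> R. s < r})"

lemma rsign_square [simp]: "rsign R r * rsign R r = 1" "rsign R r * (rsign R r * x) = x"
  by (simp_all add: rsign_def)

lemma rsign_insert_self [simp]: "rsign (insert i R) i = rsign R i"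
  unfolding rsign_def by (rule arg_cong[where f = "\<lambda>S. ksign (card S)"]) auto

lemma rsign_remove_self [simp]: "rsign (R - {i}) i = rsign R i"
  unfolding rsign_def by (rule arg_cong[where f = "\<lambda>S. ksign (card S)"]) auto

lemma rsign_insert_less:
  assumes "finite R" "i \<notin> R"
  shows "rsign (insert i R) r = (if i < r then - rsign R r else rsign R r)"
proof -
  have "{s \<in> insert i R. s < r} = (if i < r then insert i {s \<in> R. s < r} else {s \<in> R. s < r})"
    by auto
  then show ?thesis using assms by (simp add: rsign_def ksign_Suc)
qed

text \<open>Taking the rows \<open>i\<close> and \<open>r\<close> out of \<open>insert i R\<close>
  in the two possible orders differs by one transposition.\<close>

lemma rsign_exchange:
  assumes "finite R" "i \<notin> R" "r \<in> R"
  shows "rsign R i * rsign (insert i R) r = - (rsign R r * rsign (R - {r}) i)"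
proof -
  have "rsign R i = (if r < i then - rsign (R - {r}) i else rsign (R - {r}) i)"
    using rsign_insert_less[of "R - {r}" r i] assms by (simp add: insert_absorb)
  moreover have "r \<noteq> i" using assms by auto
  ultimately show ?thesis
    using rsign_insert_less[OF assms(1,2), of r] by auto
qed

text \<open>Products are taken in the order of the columns, so that permuting the rows produces
  ordinary signs only and no Koszul signs.\<close>

primrec sdet :: "(nat \<Rightarrow> 'l \<Rightarrow> 'a::real_algebra_1) \<Rightarrow> nat set \<Rightarrow> 'l list \<Rightarrow> 'a" where
  "sdet u R [] = (if R = {} then 1 else 0)"
| "sdet u R (a # w) = (\<Sum>r\<in>R. rsign R r *\<^sub>R (u r a * sdet u (R - {r}) w))"

definition row_prod :: "(nat \<Rightarrow> 'l \<Rightarrow> 'a::real_algebra_1) \<Rightarrow> nat list \<Rightarrow> 'l list \<Rightarrow> 'a" where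
  "row_prod u l w = prod_list (map2 u l w)"

lemma row_prod_simps [simp]:
  "row_prod u [] w = 1"
  "row_prod u (r # l) (a # w) = u r a * row_prod u l w"
  by (simp_all add: row_prod_def)

lemma row_prod_append: "length l = length w \<Longrightarrow> row_prod u (l @ l') (w @ w') = row_prod u l w * row_prod u l' w'"
  by (simp add: row_prod_def)

abbreviation "psg \<equiv> sg (\<lambda>_. 0)"

text \<open>The recursion expands along the first column and hides exchanges of columns further
  inside. In this Leibniz form such an exchange is a reindexing of the sum.\<close>

lemma sdet_permutations:
  assumes "finite R" "card R = length w"
  shows "sdet u R w = (\<Sum>l\<in>permutations_of_set R. psg l *\<^sub>R row_prod u l w)"
  using assms
proof (induction w arbitrary: R)
  case (Cons a w)
  have ne: "R \<noteq> {}" using Cons.prems by auto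
  \<comment> \<open>The inversions of the leading entry \<open>r\<close> are the rows smaller than
    \<open>r\<close>, which are those that \<open>rsign\<close> counts.\<close>
  have psg: "psg (r # l) = rsign R r * psg l" if "r \<in> R" "l \<in> permutations_of_set (R - {r})" for r l
  proof -
    have "(\<Prod>y\<in>set l. if y < r then - ksign (0 * 0) else 1) = (\<Prod>y\<in>R - {r}. if y < r then - 1 else (1::real))"
      using that by (simp add: permutations_of_set_def cong: if_cong)
    also have "\<dots> = (\<Prod>y\<in>{s \<in> R. s < r}. - 1)"
      by (rule prod.mono_neutral_cong_right) (use Cons.prems in auto)
    finally show ?thesis by (simp add: rsign_def ksign_def)
  qed
  have "(\<Sum>l\<in>permutations_of_set R. psg l *\<^sub>R row_prod u l (a # w))
     = (\<Sum>r\<in>R. \<Sum>l\<in>(#) r ` permutations_of_set (R - {r}). psg l *\<^sub>R row_prod u l (a # w))"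
    unfolding permutations_of_set_nonempty[OF ne]
    by (rule sum.UNION_disjoint) (use Cons.prems in auto)
  also have "\<dots> = (\<Sum>r\<in>R. \<Sum>l\<in>permutations_of_set (R - {r}). psg (r # l) *\<^sub>R row_prod u (r # l) (a # w))"
    by (intro sum.cong[OF refl]) (simp add: sum.reindex del: sg.simps row_prod_simps)
  also have "\<dots> = (\<Sum>r\<in>R. rsign R r *\<^sub>R (u r a * sdet u (R - {r}) w))"
  proof (intro sum.cong refl)
    fix r assume r: "r \<in> R"
    then have "sdet u (R - {r}) w = (\<Sum>l\<in>permutations_of_set (R - {r}). psg l *\<^sub>R row_prod u l w)"
      using Cons.prems by (intro Cons.IH) auto
    then show "(\<Sum>l\<in>permutations_of_set (R - {r}). psg (r # l) *\<^sub>R row_prod u (r # l) (a # w)) =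
         rsign R r *\<^sub>R (u r a * sdet u (R - {r}) w)"
      using psg[OF r] by (simp add: sum_distrib_left scaleR_sum_right del: sg.simps)
  qed
  finally show ?case by simp
qed simp

text \<open>The \<open>m i\<close> are the cofactors of the last column. They do not depend on
  \<open>b\<close>, and they stand to its left because products follow the order of the columns;
  hence an identity for the entries \<open>u i b\<close> can be multiplied by them directly.\<close>

lemma sdet_snoc:
  assumes "finite R"
  shows "\<exists>m. \<forall>b. sdet u R (w @ [b]) = (\<Sum>i\<in>R. m i * u i b)"
  using assms
proof (induction w arbitrary: R)
  case Nil
  show ?case
    by (rule exI[of _ "\<lambda>i. rsign R i *\<^sub>R (if R - {i} = {} then 1 else 0)"]) (auto intro!: sum.cong)
next
  case (Cons x w)
  have "\<forall>r. \<exists>m. \<forall>b. sdet u (R - {r}) (w @ [b]) = (\<Sum>i\<in>R - {r}. m i * u i b)"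
    using Cons by blast
  then obtain m where m: "\<And>r b. sdet u (R - {r}) (w @ [b]) = (\<Sum>i\<in>R - {r}. m r i * u i b)"
    by metis
  define m' where "m' i = (\<Sum>r\<in>R. if r = i then 0 else rsign R r *\<^sub>R (u r x * m r i))" for i
  have "sdet u R ((x # w) @ [b]) = (\<Sum>i\<in>R. m' i * u i b)" for b
  proof -
    have "sdet u R ((x # w) @ [b]) = (\<Sum>r\<in>R. \<Sum>i\<in>R - {r}. rsign R r *\<^sub>R (u r x * m r i * u i b))"
      by (simp add: m sum_distrib_left scaleR_sum_right mult.assoc)
    also have "\<dots> = (\<Sum>r\<in>R. \<Sum>i\<in>R. (if r = i then 0 else rsign R r *\<^sub>R (u r x * m r i)) * u i b)"
      by (intro sum.cong refl sum.mono_neutral_cong_left) (use Cons.prems in auto)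
    also have "\<dots> = (\<Sum>i\<in>R. m' i * u i b)"
      unfolding m'_def sum_distrib_right by (rule sum.swap)
    finally show ?thesis .
  qed
  then show ?case by blast
qed

lemma sdet_zero_column:
  "p < length w \<Longrightarrow> (\<And>r. r \<in> R \<Longrightarrow> u r (w ! p) = 0) \<Longrightarrow> sdet u R w = 0"
proof (induction w arbitrary: p R)
  case (Cons a w)
  show ?case
  proof (cases p)
    case (Suc p')
    have "sdet u (R - {r}) w = 0" for r
      using Cons.prems Suc by (intro Cons.IH[of p']) auto
    then show ?thesis by simp
  qed (use Cons.prems in simp)
qed simp

text \<open>An off-diagonal row \<open>s\<close> chosen in the exceptional column \<open>j\<close>
  is missing in the column whose diagonal entry lies in row \<open>s\<close>, and that column is
  then zero. So the diagonal product alone survives, whatever column \<open>j\<close>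
  contains.\<close>

lemma sdet_diagonal_except:
  assumes "sorted rs" "distinct rs" "length w = length rs"
    and "\<And>p r. p < length rs \<Longrightarrow> p \<noteq> j \<Longrightarrow> r \<in> set rs \<Longrightarrow> r \<noteq> rs ! p \<Longrightarrow> u r (w ! p) = 0"
  shows "sdet u (set rs) w = row_prod u rs w"
  using assms
proof (induction rs arbitrary: w j)
  case (Cons r rs)
  then obtain a w' where w: "w = a # w'" by (cases w) auto
  have R: "set (r # rs) - {r} = set rs" using Cons.prems by auto
  have "{s \<in> set (r # rs). s < r} = {}" using Cons.prems(1) by auto
  then have sgn: "rsign (set (r # rs)) r = 1" by (simp only: rsign_def) simp
  have rec: "sdet u (set rs) w' = row_prod u rs w'"
  proof (rule Cons.IH)
    \<comment> \<open>Once the exceptional column has been split off, its index is set to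
      \<open>length rs\<close>, beyond the remaining columns, so that none of them is
      exceptional.\<close>
    fix p s assume "p < length rs" "p \<noteq> (case j of 0 \<Rightarrow> length rs | Suc j' \<Rightarrow> j')" "s \<in> set rs" "s \<noteq> rs ! p"
    then show "u s (w' ! p) = 0"
      using Cons.prems(4)[of "Suc p" s] w by (auto split: nat.splits)
  qed (use Cons.prems w in auto)
  have zero: "u s a * sdet u (set (r # rs) - {s}) w' = 0" if s: "s \<in> set (r # rs)" "s \<noteq> r" for s
  proof (cases "j = 0")
    case False
    then show ?thesis using Cons.prems(4)[of 0 s] w s by simp
  next
    case True
    from s obtain p where p: "p < length rs" "rs ! p = s" by (auto simp: in_set_conv_nth)
    have "sdet u (set (r # rs) - {s}) w' = 0"
    proof (rule sdet_zero_column[of p])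
      show "p < length w'" using p w Cons.prems(3) by simp
      fix s' assume "s' \<in> set (r # rs) - {s}"
      then show "u s' (w' ! p) = 0"
        using Cons.prems(4)[of "Suc p" s'] w p True by auto
    qed
    then show ?thesis by simp
  qed
  have "sdet u (set (r # rs)) w = (\<Sum>s\<in>set (r # rs). if s = r then u r a * sdet u (set rs) w' else 0)"
    unfolding w sdet.simps
  proof (rule sum.cong[OF refl])
    fix s assume "s \<in> set (r # rs)"
    with zero[OF this] sgn R show "rsign (set (r # rs)) s *\<^sub>R (u s a * sdet u (set (r # rs) - {s}) w') =
         (if s = r then u r a * sdet u (set rs) w' else 0)"
      by (cases "s = r") simp_all
  qed
  then show ?case using rec w by simp
qed simp

section \<open>Antisymmetric functions of words with an arbitrary parity function\<close>

definition wsum :: "('l \<Rightarrow> nat) \<Rightarrow> 'l list \<Rightarrow> nat" where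
  "wsum q w = sum_list (map q w)"

lemma wsum_simps [simp]: "wsum q [] = 0" "wsum q (a # w) = q a + wsum q w" "wsum q (u @ w) = wsum q u + wsum q w"
  by (auto simp: wsum_def)

lemma wpar_wsum: "wpar w = wsum par w"
  by (simp add: wpar_def wsum_def)

text \<open>The letter type and the parity \<open>q\<close> are left open: with \<open>par\<close>
  this covers component families, with the constant 0 the purely even matrix in
  \<open>sdet_invertible\<close>.\<close>

definition q_antisymmetric :: "('l \<Rightarrow> nat) \<Rightarrow> ('l list \<Rightarrow> 'a::real_vector) \<Rightarrow> bool" where
  "q_antisymmetric q f \<longleftrightarrow> (\<forall>us a b vs.
     f (us @ a # b # vs) = - (ksign (q a * q b) *\<^sub>R f (us @ b # a # vs)))"

lemma q_antisymmetricD: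
  "q_antisymmetric q f \<Longrightarrow> f (us @ a # b # vs) = - (ksign (q a * q b) *\<^sub>R f (us @ b # a # vs))"
  unfolding q_antisymmetric_def by blast

lemma q_antisymmetric_move:
  assumes "q_antisymmetric q f"
  shows "f (b # us @ vs) = (ksign (length us) * ksign (q b * wsum q us)) *\<^sub>R f (us @ b # vs)"
proof (induction us arbitrary: vs rule: rev_induct)
  case (snoc a us)
  have "f (b # (us @ [a]) @ vs) = f (b # us @ a # vs)" by simp
  also have "\<dots> = (ksign (length us) * ksign (q b * wsum q us)) *\<^sub>R f (us @ b # a # vs)"
    by (rule snoc.IH)
  also have "f (us @ b # a # vs) = - (ksign (q b * q a) *\<^sub>R f (us @ a # b # vs))"
    by (rule q_antisymmetricD[OF assms])
  finally show ?case
    by (simp add: ksign_Suc ksign_add distrib_left mult_ac)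
qed simp

text \<open>Exchanging two equal even letters yields \<open>f = - f\<close>. For an odd letter the
  two signs cancel and no information results.\<close>

lemma q_antisymmetric_repeated:
  assumes "q_antisymmetric q f" "even (q a)"
  shows "f (a # a # w) = 0"
proof -
  have "f (a # a # w) = - f (a # a # w)"
    using q_antisymmetricD[OF assms(1), of "[]" a a w] assms(2) by (simp add: ksign_if)
  then have "f (a # a # w) + f (a # a # w) = - f (a # a # w) + f (a # a # w)" by (rule arg_cong)
  then show ?thesis by (simp flip: scaleR_2)
qed

section \<open>Column exchanges, expansion along a row and the quadratic relations of
  determinants\<close>

context superalgebra
begin

lemma row_prod_swp:
  assumes "Suc i < length w" "length l = length w"
    and "\<And>r a. r \<in> set l \<Longrightarrow> u r a \<in> A (q a)"
  shows "row_prod u (swp i l) (swp i w) = ksign (q (w ! i) * q (w ! Suc i)) *\<^sub>R row_prod u l w"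
proof -
  obtain xs a b ys where w: "w = xs @ a # b # ys" "swp i w = xs @ b # a # ys" "i = length xs"
      "w ! i = a" "w ! Suc i = b"
    using swp_split[OF assms(1)] by metis
  obtain rs r s ss where l: "l = rs @ r # s # ss" "swp i l = rs @ s # r # ss" "i = length rs"
    using swp_split[of i l] assms(1,2) by metis
  have "u s b * u r a = ksign (q b * q a) *\<^sub>R (u r a * u s b)"
    by (rule A_commute) (use assms(3) l in auto)
  then have "u s b * (u r a * z) = ksign (q b * q a) *\<^sub>R (u r a * (u s b * z))" for z
    by (metis mult.assoc mult_scaleR_left)
  moreover have "length rs = length xs" using w l by simp
  ultimately show ?thesis
    unfolding w(2,4,5) l(2) unfolding w(1) l(1) by (simp add: row_prod_append mult.commute)
qed

text \<open>In each term of the Leibniz form the rows are exchanged along with the columns, which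
  merely swaps two adjacent factors: \<open>psg\<close> gives the minus sign, commuting the factors
  gives the Koszul sign.\<close>

lemma sdet_swp:
  assumes "finite R" "card R = length w" "Suc i < length w"
    and u: "\<And>r a. r \<in> R \<Longrightarrow> u r a \<in> A (q a)"
  shows "sdet u R (swp i w) = - (ksign (q (w ! i) * q (w ! Suc i)) *\<^sub>R sdet u R w)"
proof -
  let ?s = "ksign (q (w ! i) * q (w ! Suc i))"
  have "sdet u R (swp i w) = (\<Sum>l\<in>permutations_of_set R. psg l *\<^sub>R row_prod u l (swp i w))"
    using assms by (intro sdet_permutations) auto
  also have "\<dots> = (\<Sum>l\<in>permutations_of_set R. psg (swp i l) *\<^sub>R row_prod u (swp i l) (swp i w))"
    by (rule sum_permutations_swp[symmetric])
  also have "\<dots> = (\<Sum>l\<in>permutations_of_set R. - (?s *\<^sub>R (psg l *\<^sub>R row_prod u l w)))"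
  proof (intro sum.cong refl)
    fix l assume l: "l \<in> permutations_of_set R"
    then have len: "length l = length w" and d: "distinct l" and "set l = R"
      using assms(2) by (auto simp: permutations_of_set_def length_finite_permutations_of_set distinct_card)
    then have "row_prod u (swp i l) (swp i w) = ?s *\<^sub>R row_prod u l w"
      using u assms(3) by (intro row_prod_swp) auto
    moreover have "psg (swp i l) = - psg l"
      using sg_swp[OF d] len assms(3) by simp
    ultimately show "psg (swp i l) *\<^sub>R row_prod u (swp i l) (swp i w) = - (?s *\<^sub>R (psg l *\<^sub>R row_prod u l w))"
      by (simp add: mult.commute)
  qed
  also have "\<dots> = - (?s *\<^sub>R sdet u R w)"
    using assms by (simp add: sum_negf scaleR_sum_right sdet_permutations)
  finally show ?thesis .
qed

lemma sdet_A:
  assumes "\<And>r a. r \<in> R \<Longrightarrow> u r a \<in> A (q a)"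
  shows "sdet u R w \<in> A (wsum q w)"
  using assms
proof (induction w arbitrary: R)
  case (Cons a w)
  then have "sdet u (R - {r}) w \<in> A (wsum q w)" for r
    by (intro Cons.IH) auto
  with Cons.prems show ?case
    by (auto intro!: A_sum A_scaleR A_mult)
qed simp

definition delete :: "nat \<Rightarrow> 'l list \<Rightarrow> 'l list" where
  "delete j w = take j w @ drop (Suc j) w"

lemma delete_simps [simp]: "delete 0 (a # w) = w" "delete (Suc j) (a # w) = a # delete j w"
  by (simp_all add: delete_def)

text \<open>The formal expansion along the row \<open>i\<close> of the matrix with rows \<open>i\<close> and \<open>R\<close>.\<close>

definition row_expansion ::
  "(nat \<Rightarrow> 'l \<Rightarrow> 'a) \<Rightarrow> ('l \<Rightarrow> nat) \<Rightarrow> nat \<Rightarrow> nat set \<Rightarrow> 'l list \<Rightarrow> 'a" where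
  "row_expansion u q i R w = (\<Sum>j<length w. (ksign j * ksign (q (w ! j) * wsum q (take j w))) *\<^sub>R
     (u i (w ! j) * sdet u R (delete j w)))"

text \<open>Either row \<open>i\<close> supplies the first column, or a later one. In the latter
  case the first column is expanded over \<open>R\<close>, and pulling \<open>u r a\<close> to the
  left past \<open>u i (w ! j)\<close> cancels the contribution of \<open>a\<close> to the sign.
  Both evaluations of the expansion rest on this recursion.\<close>

lemma row_expansion_Cons:
  assumes u: "\<And>r a. r \<in> insert i R \<Longrightarrow> u r a \<in> A (q a)"
  shows "row_expansion u q i R (a # w) = u i a * sdet u R w
    - (\<Sum>r\<in>R. rsign R r *\<^sub>R (u r a * row_expansion u q i (R - {r}) w))"
proof -
  define c where "c j = ksign j * ksign (q (w ! j) * wsum q (take j w))" for j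
  have comm: "ksign (q b * q a) *\<^sub>R (u i b * (u r a * z)) = u r a * (u i b * z)" if "r \<in> R" for r b z
  proof -
    have "u i b * u r a = ksign (q b * q a) *\<^sub>R (u r a * u i b)"
      by (rule A_commute) (use u that in auto)
    then have "u i b * (u r a * z) = ksign (q b * q a) *\<^sub>R (u r a * (u i b * z))"
      by (metis mult.assoc mult_scaleR_left)
    then show ?thesis by simp
  qed
  have step: "(ksign (Suc j) * ksign (q (w ! j) * (q a + wsum q (take j w)))) *\<^sub>R
        (u i (w ! j) * sdet u R (a # delete j w)) =
      - (\<Sum>r\<in>R. rsign R r *\<^sub>R (u r a * (c j *\<^sub>R (u i (w ! j) * sdet u (R - {r}) (delete j w)))))" for j
  proof -
    have "(ksign (Suc j) * ksign (q (w ! j) * (q a + wsum q (take j w)))) *\<^sub>R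
        (u i (w ! j) * sdet u R (a # delete j w)) =
      - (\<Sum>r\<in>R. (c j * rsign R r) *\<^sub>R (ksign (q (w ! j) * q a) *\<^sub>R
          (u i (w ! j) * (u r a * sdet u (R - {r}) (delete j w)))))"
      by (simp add: c_def ksign_Suc ksign_add distrib_left sum_distrib_left scaleR_sum_right sum_negf mult_ac)
    also have "\<dots> = - (\<Sum>r\<in>R. (c j * rsign R r) *\<^sub>R
          (u r a * (u i (w ! j) * sdet u (R - {r}) (delete j w))))"
      by (simp add: comm)
    finally show ?thesis by (simp add: mult.commute)
  qed
  have "row_expansion u q i R (a # w) = u i a * sdet u R w +
    (\<Sum>j<length w. (ksign (Suc j) * ksign (q (w ! j) * (q a + wsum q (take j w)))) *\<^sub>R
        (u i (w ! j) * sdet u R (a # delete j w)))"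
    unfolding row_expansion_def by (simp add: sum.lessThan_Suc_shift del: sum.lessThan_Suc sdet.simps)
  also have "\<dots> = u i a * sdet u R w -
    (\<Sum>j<length w. \<Sum>r\<in>R. rsign R r *\<^sub>R (u r a * (c j *\<^sub>R (u i (w ! j) * sdet u (R - {r}) (delete j w)))))"
    unfolding step by (simp only: sum_negf) simp
  also have "\<dots> = u i a * sdet u R w -
    (\<Sum>r\<in>R. \<Sum>j<length w. rsign R r *\<^sub>R (u r a * (c j *\<^sub>R (u i (w ! j) * sdet u (R - {r}) (delete j w)))))"
    by (subst sum.swap) (rule refl)
  finally show ?thesis
    by (simp add: row_expansion_def c_def sum_distrib_left scaleR_sum_right)
qed

text \<open>After the induction hypothesis the recursion becomes the first-column expansion of
  \<open>sdet\<close> over \<open>insert i R\<close>, the signs agreeing by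
  \<open>rsign_exchange\<close>.\<close>

lemma row_expansion_new_row:
  assumes "finite R" "i \<notin> R" "\<And>r a. r \<in> insert i R \<Longrightarrow> u r a \<in> A (q a)"
  shows "row_expansion u q i R w = rsign R i *\<^sub>R sdet u (insert i R) w"
  using assms
proof (induction w arbitrary: R)
  case Nil
  then show ?case by (simp add: row_expansion_def)
next
  case (Cons a w)
  have IH: "row_expansion u q i (R - {r}) w = rsign (R - {r}) i *\<^sub>R sdet u (insert i R - {r}) w"
    if "r \<in> R" for r
  proof -
    have "insert i (R - {r}) = insert i R - {r}" using Cons.prems(2) that by auto
    moreover have "row_expansion u q i (R - {r}) w = rsign (R - {r}) i *\<^sub>R sdet u (insert i (R - {r})) w"
      using Cons.prems by (intro Cons.IH) auto
    ultimately show ?thesis by simp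
  qed
  have "rsign R i *\<^sub>R sdet u (insert i R) (a # w) = u i a * sdet u R w +
      (\<Sum>r\<in>R. (rsign R i * rsign (insert i R) r) *\<^sub>R (u r a * sdet u (insert i R - {r}) w))"
    using Cons.prems(1,2) by (simp add: scaleR_add_right scaleR_sum_right)
  also have "(\<Sum>r\<in>R. (rsign R i * rsign (insert i R) r) *\<^sub>R (u r a * sdet u (insert i R - {r}) w))
     = - (\<Sum>r\<in>R. rsign R r *\<^sub>R (u r a * row_expansion u q i (R - {r}) w))"
    unfolding sum_negf[symmetric]
    by (intro sum.cong refl) (use Cons.prems(1,2) in \<open>simp add: IH rsign_exchange\<close>)
  finally show ?case
    using row_expansion_Cons[of i R u q a w] Cons.prems(3) by simp
qed

text \<open>For \<open>r\<close> other than \<open>i\<close>, row \<open>i\<close> still belongs to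
  \<open>R - {r}\<close> and the term vanishes by induction. For \<open>r = i\<close> the row is new
  to \<open>R - {i}\<close>, and the resulting term cancels the leading one.\<close>

lemma row_expansion_repeated_row:
  assumes "finite R" "i \<in> R" "\<And>r a. r \<in> R \<Longrightarrow> u r a \<in> A (q a)"
  shows "row_expansion u q i R w = 0"
  using assms
proof (induction w arbitrary: R)
  case Nil
  then show ?case by (simp add: row_expansion_def)
next
  case (Cons a w)
  have IH: "row_expansion u q i (R - {r}) w = 0" if "r \<in> R" "r \<noteq> i" for r
    using Cons.prems that by (intro Cons.IH) auto
  have new: "row_expansion u q i (R - {i}) w = rsign R i *\<^sub>R sdet u R w"
    using row_expansion_new_row[of "R - {i}" i u q w] Cons.prems by (simp add: insert_absorb)
  have "(\<Sum>r\<in>R. rsign R r *\<^sub>R (u r a * row_expansion u q i (R - {r}) w))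
      = (\<Sum>r\<in>R. if r = i then u i a * sdet u R w else 0)"
    by (intro sum.cong refl) (auto simp: IH new)
  then show ?case
    using row_expansion_Cons[of i R u q a w] Cons.prems by (simp add: insert_absorb)
qed

lemma sdet_q_antisymmetric:
  assumes "finite R" and u: "\<And>r a. r \<in> R \<Longrightarrow> u r a \<in> A (q a)"
  shows "q_antisymmetric q (\<lambda>w. if length w = card R then sdet u R w else 0)"
  unfolding q_antisymmetric_def
proof (intro allI)
  fix us a b vs
  have "sdet u R (us @ a # b # vs) = - (ksign (q a * q b) *\<^sub>R sdet u R (us @ b # a # vs))"
    if "card R = length (us @ b # a # vs)"
    using sdet_swp[OF assms(1) that, of "length us" u q] u by (simp add: nth_append mult.commute)
  then show "(if length (us @ a # b # vs) = card R then sdet u R (us @ a # b # vs) else 0) =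
      - (ksign (q a * q b) *\<^sub>R (if length (us @ b # a # vs) = card R then sdet u R (us @ b # a # vs) else 0))"
    by simp
qed

text \<open>The vanishing determinant with columns \<open>b # cs\<close> and repeated row \<open>i\<close> is expanded along that row.\<close>

lemma sdet_Cramer:
  assumes "finite R" "i \<in> R" "length cs = card R" and u: "\<And>r a. r \<in> R \<Longrightarrow> u r a \<in> A (q a)"
  shows "u i b * sdet u R cs = (\<Sum>j<length cs. ksign (q b * wsum q (take j cs) + q (cs ! j) * (q b + wsum q (take j cs))) *\<^sub>R
     (u i (cs ! j) * sdet u R (cs[j := b])))"
proof -
  have move: "sdet u R (b # delete j cs) = (ksign j * ksign (q b * wsum q (take j cs))) *\<^sub>R sdet u R (cs[j := b])"
    if "j < length cs" for j
  proof -
    have anti: "q_antisymmetric q (\<lambda>w. if length w = card R then sdet u R w else 0)"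
      by (rule sdet_q_antisymmetric[OF assms(1) u])
    show ?thesis
      using q_antisymmetric_move[OF anti, of b "take j cs" "drop (Suc j) cs"] that assms(3)
      by (simp add: delete_def upd_conv_take_nth_drop min_def del: sdet.simps)
  qed
  have "0 = row_expansion u q i R (b # cs)"
    using row_expansion_repeated_row[OF assms(1,2) u] by simp
  also have "\<dots> = u i b * sdet u R cs + (\<Sum>j<length cs. (ksign (Suc j) * ksign (q (cs ! j) * (q b + wsum q (take j cs)))) *\<^sub>R
        (u i (cs ! j) * sdet u R (b # delete j cs)))"
    unfolding row_expansion_def by (simp add: sum.lessThan_Suc_shift del: sum.lessThan_Suc sdet.simps)
  also have "(\<Sum>j<length cs. (ksign (Suc j) * ksign (q (cs ! j) * (q b + wsum q (take j cs)))) *\<^sub>R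
        (u i (cs ! j) * sdet u R (b # delete j cs)))
    = - (\<Sum>j<length cs. ksign (q b * wsum q (take j cs) + q (cs ! j) * (q b + wsum q (take j cs))) *\<^sub>R
     (u i (cs ! j) * sdet u R (cs[j := b])))"
    unfolding sum_negf[symmetric]
    by (intro sum.cong refl) (simp add: move ksign_Suc ksign_add mult_ac del: sdet.simps)
  finally show ?thesis by simp
qed

lemma sdet_Pluecker:
  assumes "finite R" "length cs = card R" and u: "\<And>r a. r \<in> R \<Longrightarrow> u r a \<in> A (q a)"
  shows "sdet u R (as @ [b]) * sdet u R cs = (\<Sum>j<length cs.
    ksign (q b * wsum q (take j cs) + q (cs ! j) * (q b + wsum q (take j cs))) *\<^sub>R
     (sdet u R (as @ [cs ! j]) * sdet u R (cs[j := b])))"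
proof -
  obtain m where m: "\<And>b. sdet u R (as @ [b]) = (\<Sum>i\<in>R. m i * u i b)"
    using sdet_snoc[OF assms(1)] by metis
  define s where "s j = ksign (q b * wsum q (take j cs) + q (cs ! j) * (q b + wsum q (take j cs)))" for j
  have "sdet u R (as @ [b]) * sdet u R cs = (\<Sum>i\<in>R. m i * (u i b * sdet u R cs))"
    by (simp add: m sum_distrib_right mult.assoc)
  also have "\<dots> = (\<Sum>i\<in>R. m i * (\<Sum>j<length cs. s j *\<^sub>R (u i (cs ! j) * sdet u R (cs[j := b]))))"
    unfolding s_def by (intro sum.cong refl arg_cong2[where f = "(*)"] sdet_Cramer) (use assms in auto)
  also have "\<dots> = (\<Sum>j<length cs. \<Sum>i\<in>R. s j *\<^sub>R (m i * u i (cs ! j) * sdet u R (cs[j := b])))"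
    by (subst sum.swap) (simp add: sum_distrib_left mult.assoc)
  also have "\<dots> = (\<Sum>j<length cs. s j *\<^sub>R (sdet u R (as @ [cs ! j]) * sdet u R (cs[j := b])))"
    by (simp add: m sum_distrib_right scaleR_sum_right)
  finally show ?thesis by (simp only: s_def)
qed

end

lemma row_prod_upt: "length w = k \<Longrightarrow> row_prod u [0..<k] w = prod_list (map (\<lambda>p. u p (w ! p)) [0..<k])"
  unfolding row_prod_def by (rule arg_cong[where f = prod_list], rule nth_equalityI) auto

lemma prod_list_single:
  fixes z :: "'a::monoid_mult"
  assumes "distinct xs"
  shows "prod_list (map (\<lambda>p. if p = j then z else 1) xs) = (if j \<in> set xs then z else 1)"
  using assms by (induction xs) auto

lemma sdet_map: "sdet u R (map f w) = sdet (\<lambda>i a. u i (f a)) R w"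
  by (induction w arbitrary: R) simp_all

lemma q_antisymmetric_not_distinct:
  assumes "q_antisymmetric q f" "\<not> distinct w" "\<And>a. a \<in> set w \<Longrightarrow> even (q a)"
  shows "f w = 0"
proof -
  obtain xs ys zs a where w: "w = xs @ [a] @ ys @ [a] @ zs"
    using assms(2) not_distinct_decomp by blast
  show ?thesis
  proof (rule adjacent_swaps_induct[of "a # a # xs @ ys @ zs"])
    show "mset (a # a # xs @ ys @ zs) = mset w" by (simp add: w)
    show "f (a # a # xs @ ys @ zs) = 0"
      using assms(1,3) w by (intro q_antisymmetric_repeated) auto
    show "f (us @ b # a # vs) = 0" if "f (us @ a # b # vs) = 0" for us vs a b
      using q_antisymmetricD[OF assms(1), of us b a vs] that by simp
  qed
qed

lemma invertible_elem_scaleR: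
  fixes x :: "'a::real_algebra_1"
  assumes "invertible_elem x" "r \<noteq> 0"
  shows "invertible_elem (r *\<^sub>R x)"
proof -
  obtain y where "x * y = 1" "y * x = 1" using assms by (auto simp: invertible_elem_def)
  then show ?thesis
    using assms(2) unfolding invertible_elem_def by (intro exI[of _ "(1 / r) *\<^sub>R y"]) simp
qed

lemma invertible_mat_diagonal:
  fixes d e :: "nat \<Rightarrow> 'a::ring_1"
  assumes "\<And>i. i < k \<Longrightarrow> d i * e i = 1" "\<And>i. i < k \<Longrightarrow> e i * d i = 1"
  shows "invertible_mat (mat k k (\<lambda>(i, j). if i = j then d i else 0))"
proof -
  have prod: "mat k k (\<lambda>(i, j). if i = j then f i else 0) * mat k k (\<lambda>(i, j). if i = j then g i else 0) = 1\<^sub>m k"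
    if fg: "\<And>i. i < k \<Longrightarrow> f i * g i = 1" for f g :: "nat \<Rightarrow> 'a"
  proof (rule eq_matI)
    fix i j assume ij: "i < dim_row (1\<^sub>m k :: 'a mat)" "j < dim_col (1\<^sub>m k :: 'a mat)"
    have "(\<Sum>l = 0..<k. (if i = l then f i else 0) * (if l = j then g l else 0))
        = (\<Sum>l = 0..<k. if l = i then (if i = j then f i * g i else 0) else 0)"
      by (intro sum.cong) auto
    then show "(mat k k (\<lambda>(i, j). if i = j then f i else 0) * mat k k (\<lambda>(i, j). if i = j then g i else 0)) $$ (i, j)
        = 1\<^sub>m k $$ (i, j)"
      using ij fg by (simp add: scalar_prod_def)
  qed auto
  have "inverts_mat (mat k k (\<lambda>(i, j). if i = j then d i else 0)) (mat k k (\<lambda>(i, j). if i = j then e i else 0))"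
    and "inverts_mat (mat k k (\<lambda>(i, j). if i = j then e i else 0)) (mat k k (\<lambda>(i, j). if i = j then d i else 0))"
    unfolding inverts_mat_def using prod assms by auto
  then show ?thesis unfolding invertible_mat_def by auto
qed

text \<open>The sign picked up when the coefficients in a product of even vectors are moved to the left.\<close>

primrec coeff_sign :: "sindex list \<Rightarrow> real" where
  "coeff_sign [] = 1"
| "coeff_sign (a # w) = ksign (par a * wpar w) * coeff_sign w"

text \<open>The exponent of \<open>coeff_sign\<close> is the sum of \<open>par a * par b\<close>
  over all pairs of positions. It is symmetric in the letters, so a letter can be split off from any
  place.\<close>

lemma coeff_sign_insert:
  "coeff_sign (xs @ a # ys) = ksign (par a * (wpar xs + wpar ys)) * coeff_sign (xs @ ys)"
  by (induction xs) (simp_all add: ksign_add distrib_left mult_ac)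

lemma coeff_sign_swp [simp]: "coeff_sign (swp i w) = coeff_sign w"
  by (induction i w rule: swp.induct) (simp_all add: ksign_add distrib_left mult_ac)

lemma coeff_sign_even: "wpar w = 0 \<Longrightarrow> coeff_sign w = 1"
  by (induction w) auto

lemma super_antisymmetric_q:
  assumes "super_antisymmetric t"
  shows "q_antisymmetric par t"
  unfolding q_antisymmetric_def
proof (intro allI)
  fix us vs :: "sindex list" and a b
  show "t (us @ a # b # vs) = - (ksign (par a * par b) *\<^sub>R t (us @ b # a # vs))"
    using super_antisymmetricD[OF assms, of "length us" "us @ a # b # vs"]
    by (simp add: flip_def nth_append)
qed

lemma (in superalgebra) A_right_inverse_invertible: "x \<in> A 0 \<Longrightarrow> x * y = 1 \<Longrightarrow> invertible_elem x"
  using A_even_commute[of x y] by (auto simp: invertible_elem_def)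

text \<open>The odd part of \<open>x * y = 1\<close> says that \<open>x\<close> annihilates the odd
  part of \<open>y\<close>, which is therefore 0. It guarantees that dividing by an even component
  keeps vectors even.\<close>

lemma (in superalgebra) A_inverse:
  assumes "x \<in> A 0" "x * y = 1" "y * x = 1"
  shows "y \<in> A 0"
proof -
  obtain y0 y1 where y: "y0 \<in> A 0" "y1 \<in> A 1" "y = y0 + y1" by (rule A_decomp)
  have "x * y0 + x * y1 = 1 + 0" using assms(2) y(3) by (simp add: distrib_left)
  then have "x * y1 = 0"
    using A_mult[OF assms(1) y(1)] A_mult[OF assms(1) y(2)]
    by (intro A_decomp_unique(2)[of "x * y0" "x * y1" 1 0]) auto
  then have "y1 = 0" using assms(3) by (metis mult.assoc mult_1 mult_zero_right)
  then show ?thesis using y by simp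
qed

text \<open>The letters \<open>Inl j\<close> are the columns of \<open>M\<close> and the letters
  \<open>Inr l\<close> the unit columns. The entries of \<open>N\<close> are not assumed even, so no
  determinant of \<open>N\<close> is formed: they are collected on the right, where they do not
  interfere with the determinants.\<close>

lemma (in superalgebra) sdet_invertible:
  fixes M :: "nat \<Rightarrow> nat \<Rightarrow> 'a"
  assumes M: "\<And>i j. i < k \<Longrightarrow> j < k \<Longrightarrow> M i j \<in> A 0"
    and MN: "\<And>i l. i < k \<Longrightarrow> l < k \<Longrightarrow> (\<Sum>j<k. M i j * N j l) = (if i = l then 1 else 0)"
  shows "invertible_elem (sdet M {..<k} [0..<k])"
proof -
  define v where "v i a = (case a of Inl j \<Rightarrow> if j < k then M i j else 0 | Inr l \<Rightarrow> if l = i then 1 else 0)"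
    for i and a :: "nat + nat"
  define f where "f w = (if length w = card {..<k} then sdet v {..<k} w else 0)" for w
  have v: "v i a \<in> A 0" if "i \<in> {..<k}" for i a
    using that M by (auto simp: v_def split: sum.split)
  have anti: "q_antisymmetric (\<lambda>_. 0) f"
    unfolding f_def by (rule sdet_q_antisymmetric) (use v in auto)
  let ?cs = "map Inl [0..<k] :: (nat + nat) list"
  let ?L = "Inl ` {..<k} \<union> Inr ` {..<k} :: (nat + nat) set"
  have "\<exists>y. f (map Inr [0..<k]) = f ?cs * y"
  proof (rule reduce_to_word[where R = "\<lambda>w. \<exists>y. f w = f ?cs * y" and cs = ?cs and L = ?L])
    fix us a b vs assume "\<exists>y. f (us @ a # b # vs) = f ?cs * y"
    then obtain y where "f (us @ a # b # vs) = f ?cs * y" by blast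
    then have "f (us @ b # a # vs) = f ?cs * (- y)"
      using q_antisymmetricD[OF anti, of us b a vs] by simp
    then show "\<exists>y. f (us @ b # a # vs) = f ?cs * y" by blast
  next
    show "\<exists>y. f ?cs = f ?cs * y" by (rule exI[of _ 1]) simp
  next
    fix a w
    have "f (a # a # w) = f ?cs * 0"
      using q_antisymmetric_repeated[OF anti, of a w] by simp
    then show "\<exists>y. f (a # a # w) = f ?cs * y" by blast
  next
    fix w :: "(nat + nat) list" and b
    assume len: "Suc (length w) = length ?cs" and b: "set (b # w) \<subseteq> ?L"
      and IH: "\<And>c. c \<in> set ?cs \<Longrightarrow> \<exists>y. f (w @ [c]) = f ?cs * y"
    show "\<exists>y. f (w @ [b]) = f ?cs * y"
    proof (cases b)
      case (Inl j)
      then show ?thesis using b by (intro IH) auto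
    next
      case (Inr l)
      then have l: "l < k" using b by auto
      have "\<forall>j\<in>{..<k}. \<exists>y. f (w @ [Inl j]) = f ?cs * y" using IH by auto
      then obtain y where y: "\<And>j. j < k \<Longrightarrow> f (w @ [Inl j]) = f ?cs * y j"
        by (auto dest!: bchoice)
      obtain m where m: "\<And>b. sdet v {..<k} (w @ [b]) = (\<Sum>i<k. m i * v i b)"
        using sdet_snoc[of "{..<k}" v w] by auto
      have fw: "f (w @ [b]) = (\<Sum>i<k. m i * v i b)" for b
        using len by (simp add: f_def m)
      \<comment> \<open>The entry of the unit column \<open>Inr l\<close> in row \<open>i\<close> is
        replaced by the entry of the product of \<open>M\<close> and \<open>N\<close>; this is the
        only place where the inverse enters.\<close>
      have "f (w @ [b]) = (\<Sum>i<k. m i * (\<Sum>j<k. v i (Inl j) * N j l))"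
        unfolding fw Inr using MN l by (intro sum.cong refl) (simp add: v_def)
      also have "\<dots> = (\<Sum>j<k. f (w @ [Inl j]) * N j l)"
        unfolding fw sum_distrib_left sum_distrib_right mult.assoc by (rule sum.swap)
      also have "\<dots> = f ?cs * (\<Sum>j<k. y j * N j l)"
        by (simp add: y sum_distrib_left mult.assoc)
      finally show ?thesis by blast
    qed
  qed (auto simp: distinct_map lessThan_atLeast0)
  then obtain y where y: "f (map Inr [0..<k]) = f ?cs * y" by blast
  have "f (map Inr [0..<k]) = sdet v (set [0..<k]) (map Inr [0..<k])"
    by (simp add: f_def lessThan_atLeast0)
  also have "\<dots> = row_prod v [0..<k] (map Inr [0..<k])"
    by (rule sdet_diagonal_except[of _ _ k]) (auto simp: v_def)
  \<comment> \<open>The case \<open>p = k\<close> does not occur below \<open>k\<close>; the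
    conditional only gives the factors the shape required by \<open>prod_list_single\<close>.
    Likewise the exceptional column chosen just before is \<open>k\<close>, that is, none.\<close>
  also have "\<dots> = prod_list (map (\<lambda>p. if p = k then 0 else 1) [0..<k])"
    unfolding row_prod_upt[of "map Inr [0..<k]" k v, simplified]
    by (rule arg_cong[where f = prod_list]) (auto simp: v_def)
  also have "\<dots> = 1" by (subst prod_list_single) auto
  finally have "f ?cs * y = 1" using y by simp
  moreover have "f ?cs \<in> A 0"
    using sdet_A[of "{..<k}" v "\<lambda>_. 0" ?cs] v by (simp add: f_def wsum_def)
  moreover have "sdet M {..<k} [0..<k] = f ?cs"
  proof -
    have "f ?cs = sdet (\<lambda>i j. v i (Inl j)) {..<k} [0..<k]" by (simp add: f_def sdet_map)
    moreover have "sdet (\<lambda>i j. v i (Inl j)) R w = sdet M R w" if "set w \<subseteq> {..<k}" for R w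
      using that by (induction w arbitrary: R) (auto simp: v_def)
    ultimately show ?thesis by (auto simp: lessThan_atLeast0)
  qed
  ultimately show ?thesis using A_right_inverse_invertible by metis
qed

section \<open>Components of a product of even vectors\<close>

context superspace
begin

definition even_rows :: "nat \<Rightarrow> (nat \<Rightarrow> sindex \<Rightarrow> 'a) \<Rightarrow> bool" where
  "even_rows k u \<longleftrightarrow> (\<forall>i<k. u i \<in> homogeneous_vectors A n m 0)"

lemma even_rows_A: "even_rows k u \<Longrightarrow> i < k \<Longrightarrow> u i a \<in> A (par a)"
  unfolding even_rows_def using homogeneous_vectors_A[of "u i" 0 a] by simp

text \<open>The coefficients of the tensor product of the vectors \<open>u r\<close>, with
  \<open>r\<close> running through \<open>l\<close>; \<open>coeff_sign\<close> results from moving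
  all coordinates to the left of the basis vectors.\<close>

definition row_tensor :: "(nat \<Rightarrow> sindex \<Rightarrow> 'a) \<Rightarrow> nat list \<Rightarrow> sindex list \<Rightarrow> 'a" where
  "row_tensor u l w = (if length w = length l then coeff_sign w *\<^sub>R row_prod u l w else 0)"

lemma row_tensor_A:
  assumes "even_rows k u" "set l \<subseteq> {..<k}"
  shows "row_tensor u l w \<in> A (wpar w)"
  using assms(2)
proof (induction l arbitrary: w)
  case (Cons r l)
  show ?case
  proof (cases w)
    case (Cons a w')
    have "row_tensor u (r # l) w = ksign (par a * wpar w') *\<^sub>R (u r a * row_tensor u l w')"
      by (simp add: row_tensor_def Cons)
    also have "\<dots> \<in> A (par a + wpar w')"
      using Cons.IH[of w'] Cons.prems even_rows_A[OF assms(1), of r a]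
      by (intro A_scaleR A_mult) auto
    finally show ?thesis by (simp add: Cons)
  qed (simp add: row_tensor_def)
qed (simp add: row_tensor_def)

lemma wedge_row_tensor:
  assumes "even_rows k u" "set l \<subseteq> {..<k}"
  shows "foldr (\<lambda>v p. vector_tensor v \<otimes>\<^bsub>TA\<^esub> p) (map u l) \<one>\<^bsub>TA\<^esub> = row_tensor u l"
  using assms(2)
proof (induction l)
  case Nil
  show ?case by (auto simp: row_tensor_def TA_one)
next
  case (Cons r l)
  have "(vector_tensor (u r) \<otimes>\<^bsub>TA\<^esub> row_tensor u l) w = row_tensor u (r # l) w" for w
  proof (cases w)
    case (Cons a w')
    have "row_tensor u l w' \<in> A (wpar w')"
      using row_tensor_A[OF assms(1)] \<open>set (r # l) \<subseteq> {..<k}\<close> by simp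
    from koszul_homogeneous[OF this, of "par a"] show ?thesis
      by (simp add: vector_tensor_mult Cons row_tensor_def)
  qed (simp add: vector_tensor_mult row_tensor_def)
  then show ?case using Cons by auto
qed

lemma wedge_row_tensor_H:
  assumes "even_rows k u" "l \<in> permutations_of_set {..<k}"
  shows "wedge A n m (map u l) = ext_class A n m (row_tensor u l)" "row_tensor u l \<in> H k"
proof -
  have l: "set l \<subseteq> {..<k}" "length l = k"
    using assms(2) perm_length by (auto simp: permutations_of_set_def)
  have vt: "vector_tensor v \<in> carrier TA" if v: "v \<in> set (map u l)" for v
  proof -
    obtain i where "i < k" "v = u i" using v l by auto
    then show ?thesis using assms(1) by (auto simp: even_rows_def intro: vector_tensor_closed)
  qed
  have "wedge A n m (map u l) = ext_class A n m (row_tensor u l) \<and> row_tensor u l \<in> carrier TA"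
    unfolding wedge_row_tensor[OF assms(1) l(1), symmetric] by (rule wedge_foldr) (rule vt)
  then show "wedge A n m (map u l) = ext_class A n m (row_tensor u l)" "row_tensor u l \<in> H k"
    using l(2) by (auto simp: H_def row_tensor_def)
qed

lemma row_tensor_swp:
  assumes "even_rows k u" "l \<in> permutations_of_set {..<k}" "Suc i < k"
  shows "row_tensor u (swp i l) w = - flip i (row_tensor u l) w"
proof (cases "length w = k")
  case True
  have l: "set l = {..<k}" "length l = k"
    using assms(2) perm_length by (auto simp: permutations_of_set_def)
  have "row_prod u (swp i l) (swp i (swp i w)) =
      ksign (par (swp i w ! i) * par (swp i w ! Suc i)) *\<^sub>R row_prod u l (swp i w)"
    by (rule row_prod_swp) (use True l assms(3) even_rows_A[OF assms(1)] in auto)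
  then show ?thesis
    using True l assms(3) by (simp add: row_tensor_def flip_def mult.commute)
next
  case False
  then show ?thesis
    using perm_length[OF assms(2)] by (simp add: row_tensor_def flip_def)
qed

text \<open>The average of the tensors of all orderings of the rows, with signs. Rearranging the
  rows keeps the columns fixed, so the Koszul factor is common to all terms and a determinant
  remains.\<close>

definition wedge_components :: "nat \<Rightarrow> (nat \<Rightarrow> sindex \<Rightarrow> 'a) \<Rightarrow> sindex list \<Rightarrow> 'a" where
  "wedge_components k u w = (if length w = k then (coeff_sign w / fact k) *\<^sub>R sdet u {..<k} w else 0)"

lemma wedge_components_sum:
  "wedge_components k u w = (1 / fact k) *\<^sub>R (\<Sum>l\<in>permutations_of_set {..<k}. psg l *\<^sub>R row_tensor u l w)"
proof (cases "length w = k")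
  case True
  have "(\<Sum>l\<in>permutations_of_set {..<k}. psg l *\<^sub>R row_tensor u l w) =
      coeff_sign w *\<^sub>R (\<Sum>l\<in>permutations_of_set {..<k}. psg l *\<^sub>R row_prod u l w)"
    unfolding scaleR_sum_right
    by (intro sum.cong refl) (simp add: row_tensor_def True perm_length mult.commute)
  also have "\<dots> = coeff_sign w *\<^sub>R sdet u {..<k} w"
    using True by (simp add: sdet_permutations)
  finally show ?thesis using True by (simp add: wedge_components_def)
next
  case False
  then have "row_tensor u l w = 0" if "l \<in> permutations_of_set {..<k}" for l
    using perm_length[OF that] by (simp add: row_tensor_def)
  then show ?thesis using False by (simp add: wedge_components_def)
qed

text \<open>Even vectors anticommute in the exterior algebra, here expressed through
  representatives: exchanging two rows is minus a flip, and flips are trivial modulo the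
  ideal.\<close>

lemma row_tensor_EI:
  assumes "even_rows k u" "l \<in> permutations_of_set {..<k}"
  shows "(\<lambda>w. row_tensor u [0..<k] w - psg l *\<^sub>R row_tensor u l w) \<in> EI"
  using assms(2)
proof (induction rule: permutations_induct)
  case base
  then show ?case by (simp add: EI_zero)
next
  case (swap i l)
  have l: "distinct l" "length l = k"
    using swap perm_length by (auto simp: permutations_of_set_def)
  have "row_tensor u [0..<k] w - psg (swp i l) *\<^sub>R row_tensor u (swp i l) w =
      (row_tensor u [0..<k] w - psg l *\<^sub>R row_tensor u l w)
      + psg l *\<^sub>R (row_tensor u l w - flip i (row_tensor u l) w)" for w
    using sg_swp[OF l(1), of i "\<lambda>_. 0"] l(2) swap(1) row_tensor_swp[OF assms(1) swap(2,1)]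
    by (simp add: scaleR_diff_right)
  moreover have "(\<lambda>w. psg l *\<^sub>R (row_tensor u l w - flip i (row_tensor u l) w)) \<in> EI"
    by (intro EI_scaleR flip_EI[OF wedge_row_tensor_H(2)[OF assms(1) swap(2)] swap(1)])
  ultimately show ?case using EI_add[OF swap(3)] by (simp only:)
qed

text \<open>The representative is averaged over the orderings of the vectors and not over the
  rearrangements of the word as in \<open>Alt\<close>. The signs are then ordinary ones, and the
  average is recognised as a determinant.\<close>

lemma is_components_wedge:
  assumes "even_rows k u"
  shows "is_components A n m k (wedge A n m (map u [0..<k])) (wedge_components k u)"
proof -
  let ?P = "permutations_of_set {..<k}" and ?t = "wedge_components k u"
  have idP: "[0..<k] \<in> ?P" by (auto simp: permutations_of_set_def)
  note id = wedge_row_tensor_H[OF assms idP]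
  have tH: "?t \<in> H k"
    using wedge_row_tensor_H(2)[OF assms] by (simp add: H_iff wedge_components_sum)
  have "(\<lambda>w. (1 / fact k) *\<^sub>R (\<Sum>l\<in>?P. row_tensor u [0..<k] w - psg l *\<^sub>R row_tensor u l w)) \<in> EI"
    by (intro EI_scaleR EI_sum row_tensor_EI assms)
  moreover have "(1 / fact k) *\<^sub>R (\<Sum>l\<in>?P. row_tensor u [0..<k] w - psg l *\<^sub>R row_tensor u l w)
      = row_tensor u [0..<k] w - ?t w" for w
  proof -
    have "(\<Sum>l\<in>?P. row_tensor u [0..<k] w) = fact k *\<^sub>R row_tensor u [0..<k] w"
      by (simp add: sum_constant_scaleR del: sum_constant)
    then show ?thesis
      by (simp add: sum_subtractf wedge_components_sum scaleR_diff_right)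
  qed
  ultimately have "ext_class A n m (row_tensor u [0..<k]) = ext_class A n m ?t"
    using id(2) tH by (subst ext_class_eq_iff) (auto simp: H_def)
  moreover have "super_antisymmetric ?t"
    unfolding super_antisymmetric_def
  proof safe
    fix i and w :: "sindex list" assume i: "Suc i < length w"
    show "?t w = flip i ?t w"
    proof (cases "length w = k")
      case True
      have "sdet u {..<k} (swp i (swp i w)) =
          - (ksign (par (swp i w ! i) * par (swp i w ! Suc i)) *\<^sub>R sdet u {..<k} (swp i w))"
        by (rule sdet_swp) (use True i even_rows_A[OF assms] in auto)
      then show ?thesis
        using True i by (simp add: wedge_components_def flip_def mult.commute)
    qed (simp add: wedge_components_def flip_def)
  qed
  moreover have "?t w \<in> A (wpar w)" for w
    using sdet_A[of "{..<k}" u par w] even_rows_A[OF assms]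
    by (auto simp: wedge_components_def wpar_wsum intro: A_scaleR)
  ultimately show ?thesis
    unfolding is_components_iff using id(1) tH by simp
qed

end

subsection \<open>The Pluecker relations\<close>

context superspace
begin

definition pluecker :: "nat \<Rightarrow> (sindex list \<Rightarrow> 'a) \<Rightarrow> bool" where
  "pluecker k t \<longleftrightarrow> (\<forall>as\<in>words n m (k - 1). \<forall>b\<in>ix. \<forall>cs\<in>words n m k.
     ksign (par b * (wpar as + wpar cs)) *\<^sub>R (t (as @ [b]) * t cs) =
     (\<Sum>j<k. ksign (par b * wpar (take j cs) + par (cs ! j) * (wpar as + wpar (drop (Suc j) cs))) *\<^sub>R
       (t (as @ [cs ! j]) * t (cs[j := b]))))"

lemma pluecker_wedge:
  assumes "even_rows k u" "1 \<le> k"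
  shows "pluecker k (wedge_components k u)"
  unfolding pluecker_def
proof (intro ballI)
  fix as b cs
  assume as: "as \<in> words n m (k - 1)" and cs: "cs \<in> words n m k"
  define N where "N = (1 / fact k :: real)"
  define D where "D = sdet u {..<k}"
  have len: "length as = k - 1" "length cs = k" using as cs by (auto simp: words_def)
  have t: "wedge_components k u w = (N * coeff_sign w) *\<^sub>R D w" if "length w = k" for w
    using that by (simp add: wedge_components_def N_def D_def)
  \<comment> \<open>The relation for determinants carries the signs of column order. Writing
    \<open>cs\<close> as \<open>X @ c # Y\<close> and splitting off \<open>b\<close> and
    \<open>c\<close> from every \<open>coeff_sign\<close> leaves the same remainder on both sides;
    the rest is a comparison of exponents modulo 2.\<close>
  have signs: "ksign (par b * (wpar as + wpar cs)) * (coeff_sign (as @ [b]) * coeff_sign cs) *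
        ksign (par b * wsum par (take j cs) + par (cs ! j) * (par b + wsum par (take j cs)))
      = ksign (par b * wpar (take j cs) + par (cs ! j) * (wpar as + wpar (drop (Suc j) cs))) *
        (coeff_sign (as @ [cs ! j]) * coeff_sign (cs[j := b]))" if "j < k" for j
  proof -
    define X Y c where "X = take j cs" and "Y = drop (Suc j) cs" and "c = cs ! j"
    have cs': "cs = X @ c # Y" "cs[j := b] = X @ b # Y"
      using that len by (auto simp: X_def Y_def c_def id_take_nth_drop[symmetric] upd_conv_take_nth_drop)
    have "ksign (par b * (wpar as + wpar (X @ c # Y))) * (ksign (par b * wpar as) * ksign (par c * (wpar X + wpar Y))) *
        ksign (par b * wpar X + par c * (par b + wpar X)) =
      ksign (par b * wpar X + par c * (wpar as + wpar Y)) * (ksign (par c * wpar as) * ksign (par b * (wpar X + wpar Y)))"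
      unfolding ksign_add[symmetric] by (rule ksign_eq) auto
    then have "(ksign (par b * (wpar as + wpar (X @ c # Y))) * (ksign (par b * wpar as) * ksign (par c * (wpar X + wpar Y))) *
        ksign (par b * wpar X + par c * (par b + wpar X))) * (coeff_sign as * coeff_sign (X @ Y)) =
      (ksign (par b * wpar X + par c * (wpar as + wpar Y)) * (ksign (par c * wpar as) * ksign (par b * (wpar X + wpar Y))))
       * (coeff_sign as * coeff_sign (X @ Y))"
      by (rule arg_cong)
    then show ?thesis
      unfolding X_def[symmetric] Y_def[symmetric] c_def[symmetric] cs'(2)
      unfolding cs'(1) coeff_sign_insert wpar_wsum[symmetric]
      by (simp only: mult_ac append_Nil2 wpar_simps add_0_right)
  qed
  have "D (as @ [b]) * D cs = (\<Sum>j<k.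
    ksign (par b * wsum par (take j cs) + par (cs ! j) * (par b + wsum par (take j cs))) *\<^sub>R
     (D (as @ [cs ! j]) * D (cs[j := b])))"
    using sdet_Pluecker[of "{..<k}" cs u par as b] len even_rows_A[OF assms(1)] by (simp add: D_def)
  then have "ksign (par b * (wpar as + wpar cs)) *\<^sub>R
        (wedge_components k u (as @ [b]) * wedge_components k u cs) =
     (\<Sum>j<k. (N * N * (ksign (par b * (wpar as + wpar cs)) * (coeff_sign (as @ [b]) * coeff_sign cs) *
        ksign (par b * wsum par (take j cs) + par (cs ! j) * (par b + wsum par (take j cs))))) *\<^sub>R
        (D (as @ [cs ! j]) * D (cs[j := b])))"
    using len assms(2) by (simp add: t scaleR_sum_right mult_ac)
  also have "\<dots> = (\<Sum>j<k. ksign (par b * wpar (take j cs) + par (cs ! j) * (wpar as + wpar (drop (Suc j) cs))) *\<^sub>R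
       (wedge_components k u (as @ [cs ! j]) * wedge_components k u (cs[j := b])))"
  proof (intro sum.cong refl)
    fix j assume "j \<in> {..<k}"
    then have j: "j < k" by simp
    show "(N * N * (ksign (par b * (wpar as + wpar cs)) * (coeff_sign (as @ [b]) * coeff_sign cs) *
        ksign (par b * wsum par (take j cs) + par (cs ! j) * (par b + wsum par (take j cs))))) *\<^sub>R
        (D (as @ [cs ! j]) * D (cs[j := b])) =
      ksign (par b * wpar (take j cs) + par (cs ! j) * (wpar as + wpar (drop (Suc j) cs))) *\<^sub>R
       (wedge_components k u (as @ [cs ! j]) * wedge_components k u (cs[j := b]))"
      unfolding signs[OF j] using len assms(2) by (simp add: t mult_ac)
  qed
  finally show "ksign (par b * (wpar as + wpar cs)) *\<^sub>R
        (wedge_components k u (as @ [b]) * wedge_components k u cs) = \<dots>" .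
qed

lemma wpar_even_word: "(\<And>a. a \<in> set w \<Longrightarrow> par a = 0) \<Longrightarrow> wpar w = 0"
  by (induction w) auto

text \<open>The relations with a fixed invertible component \<open>t cs\<close> express every component through
  those that differ from it in at most one index.\<close>

lemma pluecker_determined:
  assumes t: "super_antisymmetric t" "pluecker k t"
    and t': "super_antisymmetric t'" "pluecker k t'"
    and cs: "cs \<in> words n m k" "\<And>a. a \<in> set cs \<Longrightarrow> par a = 0" "distinct cs"
    and inv: "t cs * y = 1"
    and eq: "t cs = t' cs" "\<And>b j. b \<in> ix \<Longrightarrow> j < k \<Longrightarrow> t (cs[j := b]) = t' (cs[j := b])"
    and w: "w \<in> words n m k" and k: "1 \<le> k"
  shows "t w = t' w"
proof (rule reduce_to_word[where R = "\<lambda>w. t w = t' w" and cs = cs and L = ix])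
  fix us a b vs assume *: "t (us @ a # b # vs) = t' (us @ a # b # vs)"
  show "t (us @ b # a # vs) = t' (us @ b # a # vs)"
    unfolding q_antisymmetricD[OF super_antisymmetric_q[OF t(1)], of us b a vs]
      q_antisymmetricD[OF super_antisymmetric_q[OF t'(1)], of us b a vs] * ..
next
  fix a w assume "set (a # w) \<subseteq> set cs"
  then have "even (par a)" using cs(2) by simp
  then show "t (a # a # w) = t' (a # a # w)"
    using q_antisymmetric_repeated[OF super_antisymmetric_q[OF t(1)], of a w]
      q_antisymmetric_repeated[OF super_antisymmetric_q[OF t'(1)], of a w] by simp
next
  fix v b assume v: "Suc (length v) = length cs" "set (b # v) \<subseteq> ix"
    and IH: "\<And>c. c \<in> set cs \<Longrightarrow> t (v @ [c]) = t' (v @ [c])"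
  have len: "length cs = k" using cs(1) by (simp add: words_def)
  have v': "v \<in> words n m (k - 1)" "b \<in> ix" using v len by (auto simp: words_def)
  let ?s = "ksign (par b * (wpar v + wpar cs))"
  \<comment> \<open>Every product on the right-hand side of the relation is already known to agree:
    its first factor ends in a letter of \<open>cs\<close>, and its second differs from
    \<open>t cs\<close> in at most one index.\<close>
  have "?s *\<^sub>R (t (v @ [b]) * t cs) = ?s *\<^sub>R (t' (v @ [b]) * t' cs)"
    using t(2)[unfolded pluecker_def, rule_format, OF v' cs(1)]
      t'(2)[unfolded pluecker_def, rule_format, OF v' cs(1)]
    by (simp add: IH len eq(2)[OF v'(2)])
  then have "t (v @ [b]) * t cs = t' (v @ [b]) * t cs" by (simp add: eq(1))
  then have "t (v @ [b]) * (t cs * y) = t' (v @ [b]) * (t cs * y)"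
    by (simp only: mult.assoc[symmetric])
  then show "t (v @ [b]) = t' (v @ [b])" by (simp add: inv)
qed (use cs w eq in \<open>auto simp: words_def\<close>)

section \<open>The two directions of the equivalence\<close>

lemma simple_imp_nondegenerate:
  assumes "even_rows k u" "independent_vectors n k u"
  shows "nondegenerate A n m k (wedge A n m (map u [0..<k]))"
proof -
  obtain c where c: "c ` {..<k} \<subseteq> {1..n}" "inj_on c {..<k}"
    and M: "invertible_mat (mat k k (\<lambda>(i, j). u i (Inl (c j))))"
    using assms(2) unfolding independent_vectors_def by blast
  let ?M = "mat k k (\<lambda>(i, j). u i (Inl (c j)))"
  define cs where "cs = map (\<lambda>j. Inl (c j) :: sindex) [0..<k]"
  obtain B where B: "?M * B = 1\<^sub>m k" "B * ?M = 1\<^sub>m (dim_row B)"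
    using M unfolding invertible_mat_def inverts_mat_def by auto
  \<comment> \<open>The inverse supplied by \<open>invertible_mat\<close> comes without dimensions;
    they are read off from the two products.\<close>
  have dimB: "dim_row B = k" "dim_col B = k"
    using arg_cong[OF B(1), of dim_col] arg_cong[OF B(2), of dim_col] by auto
  have "(\<Sum>j<k. u i (Inl (c j)) * B $$ (j, l)) = (if i = l then 1 else 0)" if "i < k" "l < k" for i l
    using arg_cong[OF B(1), of "\<lambda>X. X $$ (i, l)"] that dimB
    by (simp add: scalar_prod_def lessThan_atLeast0)
  then have "invertible_elem (sdet (\<lambda>i j. u i (Inl (c j))) {..<k} [0..<k])"
    using even_rows_A[OF assms(1), of _ "Inl _"] by (intro sdet_invertible[where N = "\<lambda>j l. B $$ (j, l)"]) (auto simp: par_def)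
  then have "invertible_elem (sdet u {..<k} cs)" by (simp add: cs_def sdet_map)
  moreover have even: "par a = 0" if "a \<in> set cs" for a using that by (auto simp: cs_def par_def)
  ultimately have "invertible_elem (wedge_components k u cs)"
    using coeff_sign_even[of cs] wpar_even_word[of cs]
    by (simp add: wedge_components_def cs_def[THEN arg_cong[where f = length]] invertible_elem_scaleR)
  moreover have "cs \<in> words n m k"
  proof -
    have "Inl (c j) \<in> ix" if "j < k" for j using c(1) that unfolding indices_def by blast
    then show ?thesis by (auto simp: cs_def words_def)
  qed
  ultimately show ?thesis
    unfolding nondegenerate_def mv_components_eqI[OF is_components_wedge[OF assms(1)]]
    using even by blast
qed

lemma pluecker_imp_simple:
  assumes T: "is_components A n m k T t" and "pluecker k t" "1 \<le> k"
    and cs: "cs \<in> words n m k" "\<And>a. a \<in> set cs \<Longrightarrow> par a = 0" and "invertible_elem (t cs)"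
  shows "simple_multivector A n m k T"
proof -
  have tH: "t \<in> H k" and anti: "super_antisymmetric t" and tA: "\<And>w. t w \<in> A (wpar w)"
    and Tt: "T = ext_class A n m t"
    using T by (auto simp: is_components_iff)
  have len: "length cs = k" and cs_ix: "set cs \<subseteq> ix" using cs(1) by (auto simp: words_def)
  have repeated: "t w = 0" if "\<not> distinct w" "\<And>a. a \<in> set w \<Longrightarrow> par a = 0" for w
    using q_antisymmetric_not_distinct[OF super_antisymmetric_q[OF anti] that(1)] that(2) by simp
  obtain y where y: "t cs * y = 1" "y * t cs = 1"
    using \<open>invertible_elem (t cs)\<close> by (auto simp: invertible_elem_def)
  have dist: "distinct cs"
  proof (rule ccontr)
    assume "\<not> distinct cs"
    then have "t cs = 0" using cs(2) by (rule repeated)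
    then show False using y(1) by simp
  qed
  have tcsA: "t cs \<in> A 0" using tA[of cs] wpar_even_word[OF cs(2)] by simp
  have yA: "y \<in> A 0" by (rule A_inverse[OF tcsA y])
  \<comment> \<open>The rows \<open>y * t (cs[i := b])\<close> have the identity matrix in the
    columns \<open>cs\<close>, so their product has component \<open>1 / fact k\<close> at
    \<open>cs\<close>. Multiplying row 0 by \<open>fact k *\<^sub>R t cs\<close> corrects this to
    \<open>t cs\<close> and cancels \<open>y\<close> in that row.\<close>
  define u where "u i b = (if i = 0 then fact k *\<^sub>R t (cs[i := b]) else y * t (cs[i := b]))" for i b
  have upd_wpar: "wpar (cs[i := b]) = par b" if "i < k" for i b
  proof -
    have "par a = 0" if "a \<in> set (take i cs) \<or> a \<in> set (drop (Suc i) cs)" for a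
      using that cs(2) by (auto dest: in_set_takeD in_set_dropD)
    then have "wpar (take i cs) = 0" "wpar (drop (Suc i) cs) = 0"
      by (auto intro!: wpar_even_word)
    then show ?thesis using that len by (simp add: upd_conv_take_nth_drop)
  qed
  have "u i b \<in> A (par b)" if "i < k" for i b
    using tA[of "cs[i := b]"] upd_wpar[OF that] A_mult[OF yA, of "t (cs[i := b])" "par b"]
    by (auto simp: u_def intro: A_scaleR)
  moreover have "u i b = 0" if "b \<notin> ix" "i < k" for i b
  proof -
    have "cs[i := b] \<notin> words n m k"
      using that len set_update_memI[of i cs b] by (auto simp: words_def)
    then have "t (cs[i := b]) = 0" using tH by (simp add: H_iff)
    then show ?thesis by (auto simp: u_def)
  qed
  ultimately have rows: "even_rows k u"
    unfolding even_rows_def homogeneous_vectors_def by simp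
  \<comment> \<open>Replacing the letter at \<open>i\<close> by the one at \<open>p\<close> repeats
    an even letter, which forces the component to vanish.\<close>
  have offdiag: "u i (cs ! p) = 0" if "i < k" "p < k" "i \<noteq> p" for i p
  proof -
    have "cs[i := cs ! p] ! i = cs[i := cs ! p] ! p" using that len by simp
    then have "\<not> distinct (cs[i := cs ! p])"
      using that len by (metis length_list_update nth_eq_iff_index_eq)
    moreover have "par a = 0" if "a \<in> set (cs[i := cs ! p])" for a
      using that cs(2) set_update_subset_insert[of cs i "cs ! p"] \<open>p < k\<close> len by auto
    ultimately have "t (cs[i := cs ! p]) = 0" by (rule repeated)
    then show ?thesis by (auto simp: u_def)
  qed
  have diag: "u i (cs ! i) = (if i = 0 then fact k *\<^sub>R t cs else 1)" if "i < k" for i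
    using that len y by (simp add: u_def)
  have val: "wedge_components k u (cs[j := b]) = t (cs[j := b])" if "j < k" for j b
  proof -
    have "sdet u {..<k} (cs[j := b]) = row_prod u [0..<k] (cs[j := b])"
    proof -
      have "sdet u (set [0..<k]) (cs[j := b]) = row_prod u [0..<k] (cs[j := b])"
        \<comment> \<open>All columns of \<open>cs[j := b]\<close> other than the one at
          \<open>j\<close> are columns of \<open>cs\<close>, where the matrix is diagonal.\<close>
        by (rule sdet_diagonal_except[of _ _ j]) (use len offdiag in auto)
      then show ?thesis by (simp add: lessThan_atLeast0)
    qed
    also have "\<dots> = prod_list (map (\<lambda>p. u p (cs[j := b] ! p)) [0..<k])"
      by (rule row_prod_upt) (simp add: len)
    also have "[0..<k] = 0 # [1..<k]"
      using \<open>1 \<le> k\<close> by (simp add: upt_conv_Cons)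
    also have "map (\<lambda>p. u p (cs[j := b] ! p)) (0 # [1..<k]) =
        u 0 (cs[j := b] ! 0) # map (\<lambda>p. if p = j then y * t (cs[j := b]) else 1) [1..<k]"
      using that len by (auto simp: diag) (auto simp: u_def)
    also have "prod_list \<dots> = fact k *\<^sub>R t (cs[j := b])"
    proof (cases "j = 0")
      case True
      then show ?thesis
        using that len by (simp add: prod_list_single) (simp add: u_def)
    next
      \<comment> \<open>Row 0 contributes \<open>fact k *\<^sub>R t cs\<close> and row
        \<open>j\<close> contributes \<open>y * t (cs[j := b])\<close>; the other diagonal entries
        are 1.\<close>
      case False
      have "t cs * (y * t (cs[j := b])) = t (cs[j := b])"
        using y(1) by (simp flip: mult.assoc)
      then show ?thesis
        using False that len diag[of 0] by (simp add: prod_list_single)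
    qed
    finally have "sdet u {..<k} (cs[j := b]) = fact k *\<^sub>R t (cs[j := b])" .
    moreover have "coeff_sign (cs[j := b]) = 1"
    proof -
      have "wpar (take j cs @ drop (Suc j) cs) = 0"
        by (rule wpar_even_word) (auto dest: in_set_takeD in_set_dropD intro: cs(2))
      then show ?thesis
        using that len coeff_sign_insert[of "take j cs" b "drop (Suc j) cs"]
        by (simp add: upd_conv_take_nth_drop coeff_sign_even)
    qed
    ultimately show ?thesis using len by (simp add: wedge_components_def)
  qed
  have val_cs: "wedge_components k u cs = t cs"
    using val[of 0 "cs ! 0"] \<open>1 \<le> k\<close> by simp
  have comp: "is_components A n m k (wedge A n m (map u [0..<k])) (wedge_components k u)"
    by (rule is_components_wedge[OF rows])
  have "t w = wedge_components k u w" for w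
  proof (cases "w \<in> words n m k")
    case True
    show ?thesis
    proof (rule pluecker_determined[OF anti assms(2) _ pluecker_wedge[OF rows assms(3)] cs dist y(1)])
      show "super_antisymmetric (wedge_components k u)"
        using comp unfolding is_components_iff by (elim conjE)
      show "t cs = wedge_components k u cs" by (rule val_cs[symmetric])
      show "t (cs[j := b]) = wedge_components k u (cs[j := b])" if "j < k" for b j
        by (rule val[symmetric]) (rule that)
    qed (use True assms(3) in auto)
  next
    case False
    then show ?thesis using tH comp by (simp add: is_components_iff H_iff)
  qed
  then have "t = wedge_components k u" by (rule ext)
  then have "T = wedge A n m (map u [0..<k])"
    using Tt comp by (simp add: is_components_iff)
  moreover have "independent_vectors n k u"
  proof -
    have ex: "\<exists>a. cs ! j = Inl a \<and> a \<in> {1..n}" if "j < k" for j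
    proof -
      have "cs ! j \<in> set cs" using that len by simp
      then have "cs ! j \<in> ix" "par (cs ! j) = 0" using cs_ix cs(2) by auto
      then show ?thesis by (auto simp: indices_def par_def)
    qed
    \<comment> \<open>The letters of \<open>cs\<close> are even, so the \<open>Inr\<close> branch is
      only a default.\<close>
    define c where "c j = (case cs ! j of Inl a \<Rightarrow> a | Inr a \<Rightarrow> a)" for j
    have c: "cs ! j = Inl (c j) \<and> c j \<in> {1..n}" if "j < k" for j
      using ex[OF that] by (auto simp: c_def)
    have "inj_on c {..<k}"
    proof (rule inj_onI)
      fix i j assume ij: "i \<in> {..<k}" "j \<in> {..<k}" "c i = c j"
      then have "cs ! i = cs ! j" using c by simp
      then show "i = j" using ij dist len by (simp add: nth_eq_iff_index_eq)
    qed
    moreover have "c ` {..<k} \<subseteq> {1..n}" using c by auto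
    moreover have "mat k k (\<lambda>(i, j). u i (Inl (c j))) =
        mat k k (\<lambda>(i, j). if i = j then if i = 0 then fact k *\<^sub>R t cs else 1 else 0)"
    proof (rule cong_mat)
      fix i j assume ij: "i < k" "j < k"
      then have "Inl (c j) = cs ! j" using c by simp
      then show "(case (i, j) of (i, j) \<Rightarrow> u i (Inl (c j))) =
          (case (i, j) of (i, j) \<Rightarrow> if i = j then if i = 0 then fact k *\<^sub>R t cs else 1 else 0)"
        using ij offdiag[of i j] diag[of i] by (cases "i = j") auto
    qed auto
    moreover have "invertible_mat (mat k k (\<lambda>(i, j). if i = j then if i = 0 then fact k *\<^sub>R t cs else 1 else 0))"
      by (rule invertible_mat_diagonal[of _ _ "\<lambda>i. if i = 0 then (1 / fact k) *\<^sub>R y else 1"]) (auto simp: y)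
    ultimately show ?thesis
      unfolding independent_vectors_def by (intro exI[of _ c]) simp
  qed
  ultimately show ?thesis
    using rows unfolding simple_multivector_def even_rows_def by blast
qed

end

theorem theorem2:
  fixes A :: "nat \<Rightarrow> 'a::real_algebra_1 set"
    and n m k :: nat
    and T :: "(sindex list \<Rightarrow> 'a) set"
    and t :: "sindex list \<Rightarrow> 'a"
  defines "t \<equiv> mv_components A n m k T"
  assumes "comm_superalgebra A"
    and "1 \<le> k" and "k \<le> n"
    and "T \<in> even_multivectors A n m k"
  shows "simple_multivector A n m k T \<longleftrightarrow>
    nondegenerate A n m k T \<and>
    (\<forall>as\<in>words n m (k - 1). \<forall>b\<in>indices n m. \<forall>cs\<in>words n m k.
       t (as @ [b]) * t cs * (-1) ^ (par b * (wpar as + wpar cs)) =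
       (\<Sum>j<k. t (as @ [cs ! j]) * t (cs[j := b]) *
          (-1) ^ (par b * wpar (take j cs)
                  + par (cs ! j) * (wpar as + wpar (drop (Suc j) cs)))))"
proof -
  interpret superspace A n m by unfold_locales fact
  have comp: "is_components A n m k T t"
    unfolding t_def by (rule components_exist) fact
  have "simple_multivector A n m k T \<longleftrightarrow> nondegenerate A n m k T \<and> pluecker k t"
  proof
    assume "simple_multivector A n m k T"
    then obtain u where u: "even_rows k u" "independent_vectors n k u"
      and T: "T = wedge A n m (map u [0..<k])"
      unfolding simple_multivector_def even_rows_def by blast
    have "t = wedge_components k u"
      unfolding t_def T by (rule mv_components_eqI[OF is_components_wedge[OF u(1)]])
    then show "nondegenerate A n m k T \<and> pluecker k t"
      using pluecker_wedge[OF u(1) \<open>1 \<le> k\<close>] simple_imp_nondegenerate[OF u] T by simp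
  next
    assume *: "nondegenerate A n m k T \<and> pluecker k t"
    then obtain cs where "cs \<in> words n m k" "\<forall>a\<in>set cs. par a = 0" "invertible_elem (t cs)"
      unfolding nondegenerate_def t_def by blast
    with * show "simple_multivector A n m k T"
      by (intro pluecker_imp_simple[OF comp _ \<open>1 \<le> k\<close>]) auto
  qed
  then show ?thesis unfolding pluecker_def ksign_scaleR_right .
qed

end
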